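(* Consider the Gaussian sequence experiment with information level $n$, $Y_j=\kappa_j\theta_j+n^{-1/2}\varepsilon_j$, $j\ge 1$, where the $\varepsilon_j\sim N(0,\sigma^2)$ and the $\theta_j\sim N(0,\tau_j^2)$ are all mutually independent, $\kappa_j>0$, $\tau_j>0$, $\sigma>0$. Let $a_j=\kappa_j^2\tau_j^2/\sigma^2$, enumerated so that $a_1\ge a_2\ge\cdots>0$, and let $N(t)=\#\{j\ge 1: a_j\ge t\}$ for $t>0$. Suppose that $N(t)\sim C\,t^{-\alpha}L(1/t)$ as $t\downarrow 0$, where $C>0$, $0<\alpha<1$, and $L$ is slowly varying at infinity. Then $\sum_{j\ge1}a_j<\infty$, so that the information sum $2I(\theta;Y)=\sum_{j\ge 1}\log(1+na_j)$ is finite for every $n$, and, as $n\to\infty$, \[ 2I(\theta;Y)\sim C\pi\csc(\pi\alpha)\,n^\alpha L(n). \] Consequently, as $n\to\infty$, \[ d_{\rm eff}(n)\sim C\pi\csc(\pi\alpha)\,\frac{n^\alpha L(n)}{\log n}. \]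
   Context: $\theta=(\theta_j)_{j\ge1}$, $Y=(Y_j)_{j\ge1}$. $I(U;V)=\mathrm{KL}(P_{U,V}\,\|\,P_U\otimes P_V)$ denotes mutual information (natural logarithm), here under the joint prior–sampling law of $(\theta,Y)$ at information level $n$. The sequences $\kappa_j,\tau_j$ and $\sigma$ do not depend on $n$. Whenever $\sum_j a_j<\infty$ one has $2I(\theta;Y)=\sum_{j\ge1}\log(1+na_j)$. The Bayesian effective dimension is $d_{\rm eff}(n)=2I(\theta;Y)/\log n$ for $n\ge3$. The notation $f\sim g$ means $f/g\to1$ in the indicated limit. *)

theory Defs
  imports "HOL-Probability.Probability" "HOL-Library.Landau_Symbols"
begin

unbundle asymp_equiv_syntax

definition slowly_varying_at_top :: "(real \<Rightarrow> real) \<Rightarrow> bool" where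
  "slowly_varying_at_top L \<longleftrightarrow>
     (\<exists>x0. set_borel_measurable borel {x0..} L \<and> (\<forall>x\<ge>x0. 0 < L x)) \<and>
     (\<forall>c>0. ((\<lambda>x. L (c * x) / L x) \<longlongrightarrow> 1) at_top)"

text \<open>
  Extended-valued Kullback--Leibler divergence with natural logarithm, for probability measures
  on the same measurable space. The library's \<^const>\<open>KL_divergence\<close> takes the reference measure
  first and is real-valued, hence meaningless without absolute continuity and integrability of
  the log-density. Under absolute continuity the negative part of the log-density is always
  integrable, so non-integrability means that the divergence is infinite.
\<close>

definition KL :: "'a measure \<Rightarrow> 'a measure \<Rightarrow> ereal" where
  "KL P Q =
     (if absolutely_continuous Q P \<and> integrable P (entropy_density (exp 1) Q P)
      then ereal (KL_divergence (exp 1) Q P) else \<infinity>)"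

text \<open>
  Extended-valued counterpart of the library's \<^const>\<open>prob_space.mutual_information\<close>.
\<close>

definition mutual_info ::
    "'w measure \<Rightarrow> 'u measure \<Rightarrow> 'v measure \<Rightarrow> ('w \<Rightarrow> 'u) \<Rightarrow> ('w \<Rightarrow> 'v) \<Rightarrow> ereal" where
  "mutual_info M S T U V =
     KL (distr M (S \<Otimes>\<^sub>M T) (\<lambda>\<omega>. (U \<omega>, V \<omega>))) (distr M S U \<Otimes>\<^sub>M distr M T V)"

abbreviation seq_space :: "(nat \<Rightarrow> real) measure" where
  "seq_space \<equiv> Pi\<^sub>M UNIV (\<lambda>_. borel)"

definition observation ::
    "(nat \<Rightarrow> real) \<Rightarrow> (nat \<Rightarrow> 'w \<Rightarrow> real) \<Rightarrow> (nat \<Rightarrow> 'w \<Rightarrow> real) \<Rightarrow> real \<Rightarrow> nat \<Rightarrow> 'w \<Rightarrow> real" where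
  "observation \<kappa> \<theta> \<epsilon> n j \<omega> = \<kappa> j * \<theta> j \<omega> + n powr (- 1 / 2) * \<epsilon> j \<omega>"

definition experiment_info ::
    "'w measure \<Rightarrow> (nat \<Rightarrow> real) \<Rightarrow> (nat \<Rightarrow> 'w \<Rightarrow> real) \<Rightarrow> (nat \<Rightarrow> 'w \<Rightarrow> real) \<Rightarrow> real \<Rightarrow> ereal" where
  "experiment_info M \<kappa> \<theta> \<epsilon> n =
     mutual_info M seq_space seq_space
       (\<lambda>\<omega> j. \<theta> j \<omega>) (\<lambda>\<omega> j. observation \<kappa> \<theta> \<epsilon> n j \<omega>)"

text \<open>Only meaningful for \<open>n \<ge> 3\<close>.\<close>

definition effective_dim ::
    "'w measure \<Rightarrow> (nat \<Rightarrow> real) \<Rightarrow> (nat \<Rightarrow> 'w \<Rightarrow> real) \<Rightarrow> (nat \<Rightarrow> 'w \<Rightarrow> real) \<Rightarrow> real \<Rightarrow> ereal" where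
  "effective_dim M \<kappa> \<theta> \<epsilon> n = 2 * experiment_info M \<kappa> \<theta> \<epsilon> n / ereal (ln n)"

text \<open>
  \<open>card\<close> is \<open>0\<close> on infinite sets. An asymptotic assumption
  \<open>N(t) \<sim> C t\<^sup>-\<^sup>\<alpha> L(1/t)\<close> with an eventually positive right-hand side nevertheless
  forces all these counts to be finite: the sets grow as \<open>t\<close> decreases, so a single infinite
  one would make the count \<open>0\<close> for all smaller \<open>t\<close>.
\<close>

definition counting :: "(nat \<Rightarrow> real) \<Rightarrow> real \<Rightarrow> nat" where
  "counting a t = card {j. a j \<ge> t}"

end

theory Submission
  imports Defs
begin

text \<open>
  Information. The coordinate pairs \<open>(\<theta>\<^sub>j, Y\<^sub>j)\<close> are independent, so the joint law and the product
  of the marginals are both infinite products over \<open>j\<close>. The partial products of the coordinate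
  densities are Cauchy in \<open>L\<^sup>1\<close> of the product of the marginals because the log-densities have means
  \<open>ln (1 + n a\<^sub>j) / 2\<close> and variances at most \<open>6 n a\<^sub>j\<close>, both summable. Their limit is the density of
  the joint law, the partial log-densities converge in \<open>L\<^sup>1\<close> of the joint law, and the divergence is
  the sum of the means.

  Asymptotics. With \<open>h x = N (1 / x)\<close> one has \<open>\<Sum>\<^sub>j ln (1 + n a\<^sub>j) = \<integral> h (n / s) / (1 + s) ds\<close> over
  \<open>s > 0\<close>. The function \<open>h\<close> is monotone and regularly varying of index \<open>\<alpha>\<close>, so dominated convergence
  gives the limit \<open>\<integral> s powr (- \<alpha>) / (1 + s) ds = \<Gamma>(\<alpha>) \<Gamma>(1 - \<alpha>) = \<pi> / sin (\<pi> \<alpha>)\<close> for the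
  quotient by \<open>h n\<close>.
\<close>

subsection \<open>Regular variation and the Abelian theorem\<close>

text \<open>Infinite products with equivalent factors can be mutually singular, so a density of the
  joint law has to be constructed. Summability of \<open>a\<close> makes this possible, and it is
  therefore extracted from the counting asymptotics before any information is computed. The
  log-density of one coordinate is its mean plus a centred quadratic form whose leading term is
  linear in the square root of \<open>n * a j\<close>. Its variance is thus of first order in
  \<open>n * a j\<close>, like the mean, and plain summability of \<open>a\<close> controls both.
  Weighting by a partial product turns an integral under the product of the marginals into one under
  a law whose first coordinates already follow the joint law, so only moments under the joint law
  are needed. In the asymptotic part the obstacle is a single integrable bound for
  \<open>h (n / s) / h n\<close> on all of \<open>s > 0\<close>. Powers \<open>s powr - q\<close>
  near zero and \<open>s powr - p\<close> at infinity with \<open>0 < p < \<alpha> < q < 1\<close>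
  work as long as \<open>n / s\<close> stays large; for larger \<open>s\<close> the bound rests on
  \<open>h\<close> vanishing below \<open>1 / a 0\<close>.\<close>

lemma nn_integral_scale_powr_exp:
  fixes b u :: real
  assumes b: "b > 0" and u: "u > 0"
  shows "(\<integral>\<^sup>+s\<in>{0<..}. ennreal (s powr (b - 1) * exp (- (u * s))) \<partial>lborel) = ennreal (Gamma b * u powr - b)"
proof -
  have "ennreal (Gamma b) = (\<integral>\<^sup>+t. ennreal (indicator {0..} t * t powr (b - 1) / exp t) \<partial>lborel)"
    by (rule Gamma_conv_nn_integral_real[OF b])
  also have "\<dots> = ennreal u * (\<integral>\<^sup>+s. ennreal (indicator {0..} (0 + u * s) * (0 + u * s) powr (b - 1) / exp (0 + u * s)) \<partial>lborel)"
    using u by (subst nn_integral_real_affine[where c = u and t = 0]) auto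
  also have "(\<integral>\<^sup>+s. ennreal (indicator {0..} (0 + u * s) * (0 + u * s) powr (b - 1) / exp (0 + u * s)) \<partial>lborel)
      = (\<integral>\<^sup>+s. ennreal (u powr (b - 1)) * (ennreal (s powr (b - 1) * exp (- (u * s))) * indicator {0<..} s) \<partial>lborel)"
    using AE_lborel_singleton[of 0] u
    by (intro nn_integral_cong_AE)
       (auto elim!: eventually_mono simp: indicator_def powr_mult exp_minus field_simps zero_le_mult_iff ennreal_mult'[symmetric])
  also have "\<dots> = ennreal (u powr (b - 1)) * (\<integral>\<^sup>+s\<in>{0<..}. ennreal (s powr (b - 1) * exp (- (u * s))) \<partial>lborel)"
    by (rule nn_integral_cmult) auto
  also have "ennreal u * (ennreal (u powr (b - 1)) * (\<integral>\<^sup>+s\<in>{0<..}. ennreal (s powr (b - 1) * exp (- (u * s))) \<partial>lborel))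
     = ennreal (u powr b) * (\<integral>\<^sup>+s\<in>{0<..}. ennreal (s powr (b - 1) * exp (- (u * s))) \<partial>lborel)"
    using u by (simp add: mult.assoc[symmetric] ennreal_mult'[symmetric] powr_mult_base)
  finally have eq: "ennreal (Gamma b) = ennreal (u powr b) * (\<integral>\<^sup>+s\<in>{0<..}. ennreal (s powr (b - 1) * exp (- (u * s))) \<partial>lborel)"
    (is "_ = _ * ?I") .
  have "ennreal (Gamma b * u powr - b) = ennreal (u powr - b) * ennreal (Gamma b)"
    by (subst mult.commute, rule ennreal_mult') simp
  also have "\<dots> = (ennreal (u powr - b) * ennreal (u powr b)) * ?I"
    unfolding eq by (simp add: mult.assoc)
  also have "ennreal (u powr - b) * ennreal (u powr b) = 1"
    using u by (simp add: ennreal_mult'[symmetric] powr_add[symmetric])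
  finally show ?thesis by simp
qed

lemma Gamma_reflection_real:
  fixes \<alpha> :: real
  assumes "0 < \<alpha>" "\<alpha> < 1"
  shows "Gamma \<alpha> * Gamma (1 - \<alpha>) = pi / sin (pi * \<alpha>)"
proof -
  have "complex_of_real (Gamma \<alpha> * Gamma (1 - \<alpha>)) = Gamma (complex_of_real \<alpha>) * Gamma (1 - complex_of_real \<alpha>)"
    using Gamma_complex_of_real[of \<alpha>] Gamma_complex_of_real[of "1 - \<alpha>"] by simp
  also have "\<dots> = complex_of_real (pi / sin (pi * \<alpha>))"
    by (simp add: Gamma_reflection_complex sin_of_real flip: of_real_mult)
  finally show ?thesis by (simp only: of_real_eq_iff)
qed

text \<open>Writing \<open>1 / (1 + s)\<close> as the integral of
  \<open>exp (- (u * (1 + s)))\<close> over \<open>u > 0\<close> separates the variables. After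
  Tonelli the integral over \<open>s\<close> is
  \<open>Gamma (1 - \<alpha>) * u powr (\<alpha> - 1) * exp (- u)\<close>, and the one over
  \<open>u\<close> then contributes \<open>Gamma \<alpha>\<close>.\<close>

lemma nn_integral_powr_over_one_plus:
  fixes \<alpha> :: real
  assumes \<alpha>: "0 < \<alpha>" "\<alpha> < 1"
  shows "(\<integral>\<^sup>+s\<in>{0<..}. ennreal (s powr - \<alpha> / (1 + s)) \<partial>lborel) = ennreal (pi / sin (pi * \<alpha>))"
proof -
  have "(\<integral>\<^sup>+s\<in>{0<..}. ennreal (s powr - \<alpha> / (1 + s)) \<partial>lborel)
     = (\<integral>\<^sup>+s. (\<integral>\<^sup>+u. ennreal (s powr - \<alpha> * exp (- (u * s)) * exp (- u)) * indicator {0<..} u * indicator {0<..} s \<partial>lborel) \<partial>lborel)"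
  proof (rule nn_integral_cong)
    fix s :: real
    show "ennreal (s powr - \<alpha> / (1 + s)) * indicator {0<..} s
      = (\<integral>\<^sup>+u. ennreal (s powr - \<alpha> * exp (- (u * s)) * exp (- u)) * indicator {0<..} u * indicator {0<..} s \<partial>lborel)"
    proof (cases "s > 0")
      case True
      have "(\<integral>\<^sup>+u. ennreal (s powr - \<alpha> * exp (- (u * s)) * exp (- u)) * indicator {0<..} u * indicator {0<..} s \<partial>lborel)
         = (\<integral>\<^sup>+u. ennreal (s powr - \<alpha>) * (ennreal (u powr (1 - 1) * exp (- ((1 + s) * u))) * indicator {0<..} u) \<partial>lborel)"
        using True by (intro nn_integral_cong)
          (auto simp: indicator_def ennreal_mult'[symmetric] exp_add[symmetric] algebra_simps)
      also have "\<dots> = ennreal (s powr - \<alpha>) * ennreal (Gamma 1 * (1 + s) powr - 1)"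
        by (subst nn_integral_cmult, simp, subst nn_integral_scale_powr_exp) (use True in auto)
      also have "\<dots> = ennreal (s powr - \<alpha> / (1 + s))"
        using True by (simp add: ennreal_mult'[symmetric] powr_minus divide_simps)
      finally show ?thesis using True by simp
    qed simp
  qed
  also have "\<dots> = (\<integral>\<^sup>+u. (\<integral>\<^sup>+s. ennreal (s powr - \<alpha> * exp (- (u * s)) * exp (- u)) * indicator {0<..} u * indicator {0<..} s \<partial>lborel) \<partial>lborel)"
    by (rule lborel_pair.Fubini') simp
  also have "\<dots> = (\<integral>\<^sup>+u. ennreal (Gamma (1 - \<alpha>)) * (ennreal (u powr (\<alpha> - 1) * exp (- (1 * u))) * indicator {0<..} u) \<partial>lborel)"
  proof (rule nn_integral_cong)
    fix u :: real
    show "(\<integral>\<^sup>+s. ennreal (s powr - \<alpha> * exp (- (u * s)) * exp (- u)) * indicator {0<..} u * indicator {0<..} s \<partial>lborel)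
       = ennreal (Gamma (1 - \<alpha>)) * (ennreal (u powr (\<alpha> - 1) * exp (- (1 * u))) * indicator {0<..} u)"
    proof (cases "u > 0")
      case True
      have "(\<integral>\<^sup>+s. ennreal (s powr - \<alpha> * exp (- (u * s)) * exp (- u)) * indicator {0<..} u * indicator {0<..} s \<partial>lborel)
         = (\<integral>\<^sup>+s. ennreal (exp (- u)) * (ennreal (s powr ((1 - \<alpha>) - 1) * exp (- (u * s))) * indicator {0<..} s) \<partial>lborel)"
        using True by (intro nn_integral_cong) (auto simp: indicator_def ennreal_mult'[symmetric] mult_ac)
      also have "\<dots> = ennreal (exp (- u)) * ennreal (Gamma (1 - \<alpha>) * u powr - (1 - \<alpha>))"
        by (subst nn_integral_cmult, simp, subst nn_integral_scale_powr_exp) (use True \<alpha> in auto)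
      finally show ?thesis
        using True \<alpha> by (simp add: ennreal_mult'[symmetric] Gamma_real_pos less_imp_le mult_ac)
    qed simp
  qed
  also have "\<dots> = ennreal (Gamma (1 - \<alpha>)) * ennreal (Gamma \<alpha> * 1 powr - \<alpha>)"
    by (subst nn_integral_cmult, simp, subst nn_integral_scale_powr_exp) (use \<alpha> in auto)
  also have "\<dots> = ennreal (pi / sin (pi * \<alpha>))"
    using \<alpha> by (simp add: ennreal_mult'[symmetric] Gamma_real_pos less_imp_le mult.commute
        flip: Gamma_reflection_real)
  finally show ?thesis .
qed

section \<open>Power bounds from the doubling ratio\<close>

lemma doubling_iterate:
  fixes h :: "real \<Rightarrow> real"
  assumes "X > 0" "\<And>x. x \<ge> X \<Longrightarrow> h (2 * x) \<le> c * h x" "c \<ge> 0" "x \<ge> X"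
  shows "h (2 ^ k * x) \<le> c ^ k * h x"
proof (induction k)
  case (Suc k)
  have "1 * x \<le> 2 ^ k * x"
    using assms by (intro mult_right_mono one_le_power) auto
  then have "X \<le> 2 ^ k * x" using assms by linarith
  then have "h (2 * (2 ^ k * x)) \<le> c * h (2 ^ k * x)"
    using assms by (intro assms(2)) auto
  also have "\<dots> \<le> c * (c ^ k * h x)"
    by (intro mult_left_mono Suc assms)
  finally show ?case by (simp add: mult_ac)
qed simp

lemma doubling_iterate_lower:
  fixes h :: "real \<Rightarrow> real"
  assumes "X > 0" "\<And>x. x \<ge> X \<Longrightarrow> c * h x \<le> h (2 * x)" "c \<ge> 0" "x \<ge> X"
  shows "c ^ k * h x \<le> h (2 ^ k * x)"
proof (induction k)
  case (Suc k)
  have "1 * x \<le> 2 ^ k * x"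
    using assms by (intro mult_right_mono one_le_power) auto
  then have x: "X \<le> 2 ^ k * x" using assms by linarith
  have "c * (c ^ k * h x) \<le> c * h (2 ^ k * x)"
    by (intro mult_left_mono Suc assms)
  also have "\<dots> \<le> h (2 * (2 ^ k * x))"
    using x assms by (intro assms(2)) auto
  finally show ?case by (simp add: mult_ac)
qed simp

lemma ex_dyadic:
  fixes l :: real
  assumes "l \<ge> 1"
  obtains k :: nat where "2 ^ k \<le> l" "l < 2 ^ Suc k"
proof -
  have "\<lfloor>log 2 l\<rfloor> \<ge> 0" using assms by simp
  define k where "k = nat \<lfloor>log 2 l\<rfloor>"
  have "real k \<le> log 2 l" "log 2 l < real k + 1"
    using \<open>\<lfloor>log 2 l\<rfloor> \<ge> 0\<close> unfolding k_def by (simp_all, linarith?)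
  then have "2 powr real k \<le> l" "l < 2 powr (real (Suc k))"
    using assms by (simp_all add: le_log_iff log_less_iff add.commute)
  then show ?thesis using that[of k] by (simp only: powr_realpow)
qed

text \<open>
  Monotonicity of \<open>h\<close> lets the whole bound be iterated from the single ratio \<open>h (2 x) / h x\<close>, so
  no uniform convergence theorem for slowly varying functions is needed.
\<close>

lemma potter_bounds:
  fixes h :: "real \<Rightarrow> real"
  assumes mono: "mono h"
    and nonneg: "\<And>x. h x \<ge> 0"
    and pos: "eventually (\<lambda>x. h x > 0) at_top"
    and lim: "((\<lambda>x. h (2 * x) / h x) \<longlongrightarrow> 2 powr \<alpha>) at_top"
    and pq: "0 \<le> p" "p < \<alpha>" "\<alpha> < q"
  obtains X where "X > 0" "\<And>x. x \<ge> X \<Longrightarrow> h x > 0"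
    "\<And>x s. x \<ge> X \<Longrightarrow> 0 < s \<Longrightarrow> s \<le> 1 \<Longrightarrow> h (x / s) \<le> 2 powr q * s powr - q * h x"
    "\<And>x s. x / s \<ge> X \<Longrightarrow> 1 \<le> s \<Longrightarrow> h (x / s) \<le> 2 powr p * s powr - p * h x"
proof -
  \<comment> \<open>The strict inequalities \<open>p < \<alpha> < q\<close> leave room on both sides
    of the limit \<open>2 powr \<alpha>\<close>.\<close>
  have "eventually (\<lambda>x. h (2 * x) / h x > 2 powr p) at_top" "eventually (\<lambda>x. h (2 * x) / h x < 2 powr q) at_top"
    using pq by (auto intro!: order_tendstoD[OF lim])
  with pos eventually_gt_at_top[of 0] have "eventually (\<lambda>x. x > 0 \<and> h x > 0 \<and> 2 powr p * h x \<le> h (2 * x) \<and> h (2 * x) \<le> 2 powr q * h x) at_top"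
    by eventually_elim (auto simp: field_simps)
  then obtain X0 where X0: "\<And>x. x \<ge> X0 \<Longrightarrow> x > 0 \<and> h x > 0 \<and> 2 powr p * h x \<le> h (2 * x) \<and> h (2 * x) \<le> 2 powr q * h x"
    by (auto simp: eventually_at_top_linorder)
  have pow: "(2 powr e) ^ k = (2 ^ k) powr e" for e :: real and k :: nat
    by (simp add: powr_powr powr_realpow[symmetric] mult.commute)
  show ?thesis
  proof (rule that[of X0])
    fix x s :: real assume x: "x \<ge> X0" and s: "0 < s" "s \<le> 1"
    obtain k where k: "2 ^ k \<le> 1 / s" "1 / s < 2 ^ Suc k"
      using ex_dyadic[of "1 / s"] s by (auto simp: field_simps)
    \<comment> \<open>Rounding \<open>1 / s\<close> up to a power of two at most doubles it, which
      accounts for the factor \<open>2 powr q\<close>.\<close>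
    have "h (x / s) \<le> h (2 ^ Suc k * x)"
      using k s X0[OF x] mult_right_mono[of "1 / s" "2 ^ Suc k" x] by (intro monoD[OF mono]) auto
    also have "\<dots> \<le> (2 powr q) ^ Suc k * h x"
      using X0 x X0[of X0] by (intro doubling_iterate[of X0]) auto
    also have "\<dots> \<le> (2 * (1 / s)) powr q * h x"
      unfolding pow using k pq X0[OF x] by (intro mult_right_mono powr_mono2) auto
    also have "\<dots> = 2 powr q * s powr - q * h x"
      using s by (simp add: powr_mult powr_divide powr_minus_divide)
    finally show "h (x / s) \<le> 2 powr q * s powr - q * h x" .
  next
    fix x s :: real assume x: "x / s \<ge> X0" and s: "1 \<le> s"
    obtain k where k: "2 ^ k \<le> s" "s < 2 ^ Suc k"
      using ex_dyadic[of s] s by auto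
    \<comment> \<open>The iteration starts at \<open>x / s\<close> and climbs towards
      \<open>x\<close>, so it is \<open>x / s\<close> that must lie beyond the threshold. Rounding
      \<open>s\<close> down to \<open>2 ^ k\<close> at most halves it, hence the factor
      \<open>2 powr p\<close>.\<close>
    have "(s / 2) powr p * h (x / s) \<le> (2 powr p) ^ k * h (x / s)"
      unfolding pow using k pq s nonneg by (intro mult_right_mono powr_mono2) auto
    also have "\<dots> \<le> h (2 ^ k * (x / s))"
      using X0 x X0[of X0] by (intro doubling_iterate_lower[of X0]) auto
    also have "\<dots> \<le> h x"
      using k s X0[OF x] mult_right_mono[of "2 ^ k" s "x / s"] by (intro monoD[OF mono]) auto
    finally have "(s / 2) powr p * h (x / s) \<le> h x" .
    then show "h (x / s) \<le> 2 powr p * s powr - p * h x"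
      using s by (simp add: powr_divide powr_minus field_simps)
  qed (use X0 in auto)
qed


text \<open>For fixed \<open>s\<close> the quotient \<open>h (x / s) / h x\<close> tends to
  \<open>s powr - \<alpha>\<close>, so only domination is at stake. Vanishing of \<open>h\<close>
  below \<open>b\<close> supplies it where \<open>x / s\<close> is too small for the bounds of
  \<open>potter_bounds\<close>.\<close>

lemma abelian_stieltjes:
  fixes h :: "real \<Rightarrow> real"
  assumes mono: "mono h"
    and nonneg: "\<And>x. h x \<ge> 0"
    and pos: "eventually (\<lambda>x. h x > 0) at_top"
    and lim: "\<And>c. c > 0 \<Longrightarrow> ((\<lambda>x. h (c * x) / h x) \<longlongrightarrow> c powr \<alpha>) at_top"
    and \<alpha>: "0 < \<alpha>" "\<alpha> < 1"
    and b: "b > 0" "\<And>x. x < b \<Longrightarrow> h x = 0"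
  shows "((\<lambda>x. (LINT s:{0<..}|lborel. h (x / s) / (1 + s)) / h x) \<longlongrightarrow> pi / sin (pi * \<alpha>)) at_top"
proof -
  \<comment> \<open>Midpoints of \<open>(0, \<alpha>)\<close> and \<open>(\<alpha>, 1)\<close>:
    \<open>q < 1\<close> gives integrability at zero and \<open>p > 0\<close> gives it at
    infinity.\<close>
  define p q where "p = \<alpha> / 2" and "q = (1 + \<alpha>) / 2"
  have pq: "0 < p" "p < \<alpha>" "\<alpha> < q" "q < 1"
    using \<alpha> by (auto simp: p_def q_def)
  obtain X where X: "X > 0" "\<And>x. x \<ge> X \<Longrightarrow> h x > 0"
    and small: "\<And>x s. x \<ge> X \<Longrightarrow> 0 < s \<Longrightarrow> s \<le> 1 \<Longrightarrow> h (x / s) \<le> 2 powr q * s powr - q * h x"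
    and large: "\<And>x s. x / s \<ge> X \<Longrightarrow> 1 \<le> s \<Longrightarrow> h (x / s) \<le> 2 powr p * s powr - p * h x"
    using potter_bounds[of h \<alpha> p q] mono nonneg pos lim[of 2] pq by (auto simp: less_imp_le)
  \<comment> \<open>One summand for each nontrivial case of the bound below.\<close>
  define K where "K = 2 powr q + 2 powr p + 2 powr p * (X / b) powr p"
  have "K \<ge> 0" by (simp add: K_def)
  have sin_pos: "sin (pi * \<alpha>) > 0"
    using \<alpha> by (intro sin_gt_zero) auto
  have bound: "h (x / s) / h x \<le> K * (s powr - q + s powr - p)" if x: "x \<ge> X" and s: "s > 0" for x s
  proof -
    have hx: "h x > 0" using X x by auto
    have xpos: "x > 0" using X x by auto
    have "h (x / s) / h x \<le> 2 powr q * s powr - q \<or> h (x / s) / h x \<le> 2 powr p * s powr - p \<or>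
        h (x / s) / h x \<le> 2 powr p * (X / b) powr p * s powr - p"
    proof -
      consider "s \<le> 1" | "s > 1" "x / s \<ge> X" | "s > 1" "b \<le> x / s" "x / s < X" | "s > 1" "x / s < b" by linarith
      then show ?thesis
      proof cases
        case 1
        then show ?thesis using small[OF x s] hx by (auto simp: pos_divide_le_eq)
      next
        case 2
        then show ?thesis using large[of x s] hx by (auto simp: pos_divide_le_eq)
      next
        case 3
        \<comment> \<open>Here \<open>x / s\<close> lies between \<open>b\<close> and the threshold
          \<open>X\<close>. The bound for large \<open>s\<close> compares \<open>h X\<close> with
          \<open>h x\<close>, and \<open>b \<le> x / s\<close> bounds \<open>X / x\<close> by
          \<open>X / (b * s)\<close>, which restores a power of \<open>s\<close>.\<close>
        have "h (x / s) \<le> h X"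
          using 3 s xpos by (intro monoD[OF mono]) auto
        also have "h X \<le> 2 powr p * (x / X) powr - p * h x"
          using large[of x "x / X"] xpos X x by simp
        also have "(x / X) powr - p \<le> (X / b) powr p * s powr - p"
        proof -
          have "(x / X) powr - p = (X / x) powr p"
            using xpos X by (simp add: powr_divide powr_minus_divide)
          also have "\<dots> \<le> (X / b / s) powr p"
            using 3 pq xpos X b s by (intro powr_mono2) (auto simp: field_simps)
          also have "\<dots> = (X / b) powr p * s powr - p"
            unfolding powr_divide[of "X / b" s] powr_minus_divide by simp
          finally show ?thesis .
        qed
        finally show ?thesis
          using hx by (auto simp: pos_divide_le_eq mult_ac)
      next
        case 4
        then show ?thesis using b xpos s by simp
      qed
    qed
    moreover have "2 powr q * s powr - q \<le> K * (s powr - q + s powr - p)"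
      "2 powr p * s powr - p \<le> K * (s powr - q + s powr - p)"
      "2 powr p * (X / b) powr p * s powr - p \<le> K * (s powr - q + s powr - p)"
      unfolding K_def by (intro mult_mono; simp)+
    ultimately show ?thesis by linarith
  qed
  have int: "integrable lborel (\<lambda>s. indicator {0<..} s * (s powr - e / (1 + s)))" if e: "0 < e" "e < 1" for e :: real
  proof (rule integrableI_nonneg)
    have "(\<integral>\<^sup>+s. ennreal (indicator {0<..} s * (s powr - e / (1 + s))) \<partial>lborel)
       = (\<integral>\<^sup>+s\<in>{0<..}. ennreal (s powr - e / (1 + s)) \<partial>lborel)"
      by (intro nn_integral_cong) (auto simp: indicator_def)
    then show "(\<integral>\<^sup>+s. ennreal (indicator {0<..} s * (s powr - e / (1 + s))) \<partial>lborel) < \<infinity>"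
      using e by (simp add: nn_integral_powr_over_one_plus)
  qed (auto split: split_indicator)
  have val: "(LINT s|lborel. indicator {0<..} s * (s powr - \<alpha> / (1 + s))) = pi / sin (pi * \<alpha>)"
  proof (subst integral_eq_nn_integral)
    have "(\<integral>\<^sup>+s. ennreal (indicator {0<..} s * (s powr - \<alpha> / (1 + s))) \<partial>lborel)
       = (\<integral>\<^sup>+s\<in>{0<..}. ennreal (s powr - \<alpha> / (1 + s)) \<partial>lborel)"
      by (intro nn_integral_cong) (auto simp: indicator_def)
    then show "enn2real (\<integral>\<^sup>+s. ennreal (indicator {0<..} s * (s powr - \<alpha> / (1 + s))) \<partial>lborel) = pi / sin (pi * \<alpha>)"
      using \<alpha> sin_pos by (simp add: nn_integral_powr_over_one_plus)
  qed (auto split: split_indicator)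
  have "((\<lambda>x. LINT s|lborel. indicator {0<..} s * (h (x / s) / h x / (1 + s)))
      \<longlongrightarrow> (LINT s|lborel. indicator {0<..} s * (s powr - \<alpha> / (1 + s)))) at_top"
  proof (rule integral_dominated_convergence_at_top)
    show "integrable lborel (\<lambda>s. K * (indicator {0<..} s * (s powr - q / (1 + s)) + indicator {0<..} s * (s powr - p / (1 + s))))"
      using pq by (intro integrable_mult_right Bochner_Integration.integrable_add int) linarith+
    show "eventually (\<lambda>x. AE s in lborel. norm (indicator {0<..} s * (h (x / s) / h x / (1 + s)))
        \<le> K * (indicator {0<..} s * (s powr - q / (1 + s)) + indicator {0<..} s * (s powr - p / (1 + s)))) at_top"
      using eventually_ge_at_top[of X]
    proof eventually_elim
      case (elim x)
      show ?case
      proof (rule AE_I2)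
        fix s :: real
        show "norm (indicator {0<..} s * (h (x / s) / h x / (1 + s)))
          \<le> K * (indicator {0<..} s * (s powr - q / (1 + s)) + indicator {0<..} s * (s powr - p / (1 + s)))"
        proof (cases "s > 0")
          case True
          have "h (x / s) / h x / (1 + s) \<le> K * (s powr - q + s powr - p) / (1 + s)"
            using bound[OF elim True] True by (intro divide_right_mono) auto
          then show ?thesis
            using True X(2)[OF elim] nonneg by (simp add: abs_of_nonneg algebra_simps add_divide_distrib)
        qed simp
      qed
    qed
    show "AE s in lborel. ((\<lambda>x. indicator {0<..} s * (h (x / s) / h x / (1 + s))) \<longlongrightarrow> indicator {0<..} s * (s powr - \<alpha> / (1 + s))) at_top"
    proof (rule AE_I2)
      fix s :: real
      show "((\<lambda>x. indicator {0<..} s * (h (x / s) / h x / (1 + s))) \<longlongrightarrow> indicator {0<..} s * (s powr - \<alpha> / (1 + s))) at_top"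
      proof (cases "s > 0")
        case True
        have "((\<lambda>x. h ((1 / s) * x) / h x) \<longlongrightarrow> (1 / s) powr \<alpha>) at_top"
          using True by (intro lim) auto
        then have "((\<lambda>x. h (x / s) / h x) \<longlongrightarrow> s powr - \<alpha>) at_top"
          using True by (simp add: powr_divide powr_minus_divide)
        then show ?thesis
          using True by (intro tendsto_intros) auto
      qed simp
    qed
  next
    fix x
    show "(\<lambda>s. indicator {0<..} s * (h (x / s) / h x / (1 + s))) \<in> borel_measurable lborel"
      using borel_measurable_mono[OF mono] by measurable
  qed simp_all
  also have "(\<lambda>x. LINT s|lborel. indicator {0<..} s * (h (x / s) / h x / (1 + s)))
      = (\<lambda>x. (LINT s:{0<..}|lborel. h (x / s) / (1 + s)) / h x)"
    unfolding set_lebesgue_integral_def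
    by (subst integral_divide_zero[symmetric]) (simp add: mult_ac)
  finally show ?thesis unfolding val .
qed


section \<open>Counting function, summability and the logarithmic sum\<close>

text \<open>Monotonicity holds on the whole line because of default values: for
  \<open>x \<le> 0\<close> the threshold \<open>1 / x\<close> is nonpositive (with
  \<open>1 / 0 = 0\<close>), every index qualifies, and \<open>card\<close> of the infinite set is
  0.\<close>

lemma mono_counting_inverse:
  assumes "\<And>t. t > 0 \<Longrightarrow> finite {j. a j \<ge> t}" and pos: "\<And>j. a j > 0"
  shows "mono (\<lambda>x. real (counting a (1 / x)))"
proof (rule monoI)
  fix x y :: real assume xy: "x \<le> y"
  show "real (counting a (1 / x)) \<le> real (counting a (1 / y))"
  proof (cases "x > 0")
    case True
    then have "{j. a j \<ge> 1 / x} \<subseteq> {j. a j \<ge> 1 / y}"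
      using xy by (auto intro!: order_trans[OF divide_left_mono[of x y 1]])
    then show ?thesis
      unfolding counting_def using True xy assms(1) by (auto intro: card_mono)
  next
    case False
    then have "1 / x \<le> 0" by simp
    then have "1 / x \<le> a j" for j
      using pos[of j] by linarith
    then have "{j. a j \<ge> 1 / x} = UNIV"
      by simp
    then show ?thesis by (simp add: counting_def)
  qed
qed

text \<open>Each \<open>ln (1 + n * a j)\<close> is the integral of \<open>1 / (1 + s)\<close> over
  \<open>{0..n * a j}\<close>. Exchanging sum and integral leaves, at each \<open>s > 0\<close>, the
  number of \<open>j\<close> with \<open>a j \<ge> s / n\<close>. The threshold is kept as
  \<open>1 / (n / s)\<close> to match the argument \<open>n / s\<close> of \<open>h\<close>.\<close>

lemma sums_ln_eq_integral_counting:
  assumes fin: "\<And>t. t > 0 \<Longrightarrow> finite {j. a j \<ge> t}" and pos: "\<And>j. a j > 0"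
    and summ: "summable (\<lambda>j. ln (1 + n * a j))" and n: "n > 0"
  shows "(\<Sum>j. ln (1 + n * a j)) = (LINT s:{0<..}|lborel. real (counting a (1 / (n / s))) / (1 + s))"
proof -
  have [measurable]: "(\<lambda>x. real (counting a (1 / x))) \<in> borel_measurable borel"
    using borel_measurable_mono[OF mono_counting_inverse] fin pos by blast
  have m[measurable]: "(\<lambda>s. real (counting a (1 / (n / s)))) \<in> borel_measurable borel"
    by measurable
  have "ennreal (\<Sum>j. ln (1 + n * a j)) = (\<Sum>j. ennreal (ln (1 + n * a j)))"
    using summ n pos by (intro suminf_ennreal2[symmetric]) (auto simp: less_imp_le)
  also have "\<dots> = (\<Sum>j. \<integral>\<^sup>+s. ennreal (1 / (1 + s)) * indicator {0..n * a j} s \<partial>lborel)"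
  proof (intro suminf_cong)
    fix j
    show "ennreal (ln (1 + n * a j)) = (\<integral>\<^sup>+s. ennreal (1 / (1 + s)) * indicator {0..n * a j} s \<partial>lborel)"
      using n pos[of j] by (subst nn_integral_FTC_Icc[where F = "\<lambda>s. ln (1 + s)"])
        (auto intro!: derivative_eq_intros)
  qed
  also have "\<dots> = (\<integral>\<^sup>+s. (\<Sum>j. ennreal (1 / (1 + s)) * indicator {0..n * a j} s) \<partial>lborel)"
    by (intro nn_integral_suminf[symmetric]) simp
  also have "\<dots> = (\<integral>\<^sup>+s. ennreal (indicator {0<..} s *\<^sub>R (real (counting a (1 / (n / s))) / (1 + s))) \<partial>lborel)"
  proof (rule nn_integral_cong_AE, use AE_lborel_singleton[of 0] in eventually_elim)
    fix s :: real assume "s \<noteq> 0"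
    show "(\<Sum>j. ennreal (1 / (1 + s)) * indicator {0..n * a j} s)
        = ennreal (indicator {0<..} s *\<^sub>R (real (counting a (1 / (n / s))) / (1 + s)))"
    proof (cases "s > 0")
      case True
      have ind: "indicator {0..n * a j} s = (indicator {j. a j \<ge> s / n} j :: ennreal)" for j
        using True n by (auto simp: indicator_def field_simps)
      have f: "finite {j. a j \<ge> s / n}" using True n by (intro fin) auto
      have "(\<Sum>j. ennreal (1 / (1 + s)) * indicator {0..n * a j} s)
          = (\<Sum>j\<in>{j. a j \<ge> s / n}. ennreal (1 / (1 + s)) * indicator {0..n * a j} s)"
        by (rule suminf_finite[OF f]) (simp add: ind)
      also have "\<dots> = (\<Sum>j\<in>{j. a j \<ge> s / n}. ennreal (1 / (1 + s)))"
        by (rule sum.cong) (simp_all add: ind)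
      also have "\<dots> = ennreal (real (counting a (s / n)) / (1 + s))"
        using True by (simp add: counting_def ennreal_of_nat_eq_real_of_nat ennreal_mult'[symmetric])
      finally show ?thesis using True by simp
    next
      case False
      then have "indicator {0..n * a j} s = (0 :: ennreal)" for j
        using \<open>s \<noteq> 0\<close> by auto
      then show ?thesis using False by simp
    qed
  qed
  finally have eq: "ennreal (\<Sum>j. ln (1 + n * a j))
     = (\<integral>\<^sup>+s. ennreal (indicator {0<..} s *\<^sub>R (real (counting a (1 / (n / s))) / (1 + s))) \<partial>lborel)" .
  have "(\<Sum>j. ln (1 + n * a j)) \<ge> 0"
    using summ n pos by (intro suminf_nonneg) (auto simp: less_imp_le)
  then show ?thesis
    unfolding set_lebesgue_integral_def
    by (subst integral_eq_nn_integral)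
       (simp_all only: eq[symmetric] enn2real_ennreal, auto simp del: divide_divide_eq_right split: split_indicator)
qed

text \<open>A positive \<open>card\<close> certifies finiteness at some level \<open>s < t\<close>,
  and the set at level \<open>t\<close> is contained in that one.\<close>

lemma finite_superlevel_of_counting:
  assumes "eventually (\<lambda>t. counting a t > 0) (at_right (0::real))" "t > 0"
  shows "finite {j. a j \<ge> t}"
proof -
  obtain s where s: "0 < s" "s < t" "counting a s > 0"
    using eventually_happens'[OF _ eventually_conj[OF assms(1) eventually_at_right_less[of 0]]]
      eventually_happens'[OF _ eventually_conj[OF assms(1) eventually_at_right_real[OF assms(2)]]]
    by auto
  have "finite {j. a j \<ge> s}"
    using s(3) unfolding counting_def by (simp add: card_gt_0_iff)
  then show ?thesis
    by (rule finite_subset[rotated]) (use s in auto)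
qed

text \<open>Inversion of the counting bound: the indices up to \<open>j\<close> all have
  \<open>a i \<ge> a j\<close>, so \<open>j + 1\<close> is at most \<open>K * a j powr - q\<close>.
  Hence \<open>a j\<close> is at most a constant times \<open>(j + 1) powr (- 1 / q)\<close>, and
  \<open>q < 1\<close> makes this summable.\<close>

lemma summable_of_counting:
  fixes a :: "nat \<Rightarrow> real"
  assumes dec: "decseq a" and pos: "\<And>j. a j > 0"
    and fin: "\<And>t. t > 0 \<Longrightarrow> finite {j. a j \<ge> t}"
    and bound: "\<And>t. 0 < t \<Longrightarrow> t \<le> \<delta> \<Longrightarrow> real (counting a t) \<le> K * t powr - q" and \<delta>: "\<delta> > 0"
    and q: "0 < q" "q < 1"
  shows "summable a"
proof (rule summable_comparison_test_ev)
  \<comment> \<open>The counting bound is available only for thresholds up to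
    \<open>\<delta>\<close>; finiteness of the set at level \<open>\<delta>\<close> provides an
    index from which on \<open>a\<close> stays below it.\<close>
  have "{j. a j \<ge> \<delta>} \<noteq> UNIV"
    using fin[OF \<delta>] by auto
  then obtain j0 where "\<not> a j0 \<ge> \<delta>" by blast
  then have j0: "a j0 < \<delta>" by simp
  show "eventually (\<lambda>j. norm (a j) \<le> K powr (1 / q) * real (Suc j) powr (- 1 / q)) sequentially"
    using eventually_ge_at_top[of j0]
  proof eventually_elim
    case (elim j)
    have "a j \<le> \<delta>" using decseqD[OF dec elim] j0 by simp
    have "{..j} \<subseteq> {i. a i \<ge> a j}" using dec by (auto simp: decseq_def)
    then have "card {..j} \<le> counting a (a j)"
      unfolding counting_def by (intro card_mono fin pos)
    then have "real (Suc j) \<le> K * a j powr - q"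
      using bound[OF pos \<open>a j \<le> \<delta>\<close>] by simp
    then have *: "a j powr q \<le> K * (1 / real (Suc j))"
      using pos[of j] by (simp add: powr_minus field_simps)
    have "0 < a j powr q" using pos[of j] by simp
    also note *
    finally have "K > 0" by (simp add: zero_less_divide_iff)
    have "a j = (a j powr q) powr (1 / q)"
      using pos[of j] q by (simp add: powr_powr)
    also have "\<dots> \<le> (K * (1 / real (Suc j))) powr (1 / q)"
      using q * by (intro powr_mono2) auto
    also have "\<dots> = K powr (1 / q) * real (Suc j) powr (- 1 / q)"
      using \<open>K > 0\<close> unfolding powr_mult by (simp add: powr_divide powr_minus_divide)
    finally show ?case using pos[of j] by simp
  qed
  have "summable (\<lambda>j. real j powr (- 1 / q))"
    using q by (subst summable_real_powr_iff) (simp add: field_simps)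
  then have "summable (\<lambda>j. real (Suc j) powr (- 1 / q))"
    by (subst summable_Suc_iff)
  then show "summable (\<lambda>j. K powr (1 / q) * real (Suc j) powr (- 1 / q))"
    by (intro summable_mult)
qed

text \<open>The substitution \<open>x = 1 / t\<close> moves the hypothesis to infinity. In the ratio
  at \<open>c * x\<close> and \<open>x\<close> the constant cancels, slow variation removes
  \<open>L\<close>, and the powers leave \<open>c powr \<alpha>\<close>; convergence for each fixed
  \<open>c\<close> is all that is claimed.\<close>

lemma regular_variation_counting:
  fixes a :: "nat \<Rightarrow> real"
  assumes C: "C > 0"
    and L: "slowly_varying_at_top L"
    and asymp: "(\<lambda>t. real (counting a t)) \<sim>[at_right 0] (\<lambda>t. C * t powr (- \<alpha>) * L (1 / t))"
  defines "h \<equiv> \<lambda>x. real (counting a (1 / x))"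
  shows regular_variation_counting_asymp: "h \<sim>[at_top] (\<lambda>x. C * x powr \<alpha> * L x)"
    and regular_variation_counting_pos: "eventually (\<lambda>x. h x > 0) at_top"
    and regular_variation_counting_lim: "\<And>c. c > 0 \<Longrightarrow> ((\<lambda>x. h (c * x) / h x) \<longlongrightarrow> c powr \<alpha>) at_top"
proof -
  have "filterlim (\<lambda>x::real. 1 / x) (at_right 0) at_top"
    using filterlim_inverse_at_right_top by (simp add: inverse_eq_divide)
  from asymp_equiv_compose'[OF asymp this]
  have "h \<sim>[at_top] (\<lambda>x. C * (1 / x) powr (- \<alpha>) * L (1 / (1 / x)))"
    unfolding h_def .
  also have "(\<lambda>x. C * (1 / x) powr (- \<alpha>) * L (1 / (1 / x))) \<sim>[at_top] (\<lambda>x. C * x powr \<alpha> * L x)"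
    using eventually_gt_at_top[of 0]
    by (intro asymp_equiv_refl_ev) (auto elim!: eventually_mono simp: powr_divide powr_minus_divide)
  finally show A: "h \<sim>[at_top] (\<lambda>x. C * x powr \<alpha> * L x)" .
  obtain x0 where x0: "\<And>x. x \<ge> x0 \<Longrightarrow> L x > 0"
    using L by (auto simp: slowly_varying_at_top_def)
  have Lpos: "eventually (\<lambda>x. L x > 0) at_top"
    using eventually_ge_at_top[of x0] by eventually_elim (rule x0)
  then have Rpos: "eventually (\<lambda>x. C * x powr \<alpha> * L x > 0) at_top"
    using eventually_gt_at_top[of 0] by eventually_elim (use C in auto)
  show P: "eventually (\<lambda>x. h x > 0) at_top"
    using asymp_equiv_eventually_pos_iff[OF A] Rpos by eventually_elim auto
  fix c :: real assume c: "c > 0"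
  have clim: "filterlim (\<lambda>x. c * x) at_top at_top"
    using c by (intro filterlim_tendsto_pos_mult_at_top[OF tendsto_const _ filterlim_ident]) auto
  have "(\<lambda>x. h (c * x) / h x) \<sim>[at_top] (\<lambda>x. (C * (c * x) powr \<alpha> * L (c * x)) / (C * x powr \<alpha> * L x))"
    by (intro asymp_equiv_intros A asymp_equiv_compose'[OF A clim])
  moreover have "((\<lambda>x. (C * (c * x) powr \<alpha> * L (c * x)) / (C * x powr \<alpha> * L x)) \<longlongrightarrow> c powr \<alpha>) at_top"
  proof (rule Lim_transform_eventually)
    show "((\<lambda>x. c powr \<alpha> * (L (c * x) / L x)) \<longlongrightarrow> c powr \<alpha>) at_top"
      using L c tendsto_mult[OF tendsto_const[of "c powr \<alpha>"], of "\<lambda>x. L (c * x) / L x" 1]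
      by (simp add: slowly_varying_at_top_def)
    show "eventually (\<lambda>x. c powr \<alpha> * (L (c * x) / L x) = (C * (c * x) powr \<alpha> * L (c * x)) / (C * x powr \<alpha> * L x)) at_top"
      using eventually_gt_at_top[of 0] Lpos
      by eventually_elim (use C c in \<open>simp add: powr_mult\<close>)
  qed
  ultimately show "((\<lambda>x. h (c * x) / h x) \<longlongrightarrow> c powr \<alpha>) at_top"
    using tendsto_asymp_equiv_cong by blast
qed

lemma sum_ln_asymp:
  fixes a :: "nat \<Rightarrow> real"
  assumes dec: "decseq a" and pos: "\<And>j. a j > 0"
    and C: "C > 0" and \<alpha>: "0 < \<alpha>" "\<alpha> < 1"
    and L: "slowly_varying_at_top L"
    and asymp: "(\<lambda>t. real (counting a t)) \<sim>[at_right 0] (\<lambda>t. C * t powr (- \<alpha>) * L (1 / t))"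
  shows summable_of_regular_counting: "summable a"
    and sum_ln_asymp_equiv: "(\<lambda>n. \<Sum>j. ln (1 + n * a j)) \<sim>[at_top] (\<lambda>n. C * pi * (1 / sin (pi * \<alpha>)) * n powr \<alpha> * L n)"
proof -
  define h where "h x = real (counting a (1 / x))" for x
  note rv = regular_variation_counting[OF C L asymp, folded h_def]
  have "filterlim (\<lambda>t::real. 1 / t) at_top (at_right 0)"
    using filterlim_inverse_at_top_right by (simp add: inverse_eq_divide)
  from eventually_compose_filterlim[OF rv(2) this]
  have "eventually (\<lambda>t. counting a t > 0) (at_right 0)"
    by (auto simp: h_def)
  note fin = finite_superlevel_of_counting[OF this]
  have mono: "mono h"
    unfolding h_def by (rule mono_counting_inverse[OF fin pos])
  have nonneg: "h x \<ge> 0" for x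
    by (simp add: h_def)
  have \<alpha>': "\<alpha> < (1 + \<alpha>) / 2"
    using \<alpha> by simp
  \<comment> \<open>Only the bound for small \<open>s\<close> is kept, with \<open>p = 0\<close>
    through \<open>order_refl\<close>. The exponent \<open>(1 + \<alpha>) / 2\<close> is below one,
    as the summability criterion demands.\<close>
  obtain X where X: "X > 0" "\<And>x. x \<ge> X \<Longrightarrow> h x > 0"
    "\<And>x s. x \<ge> X \<Longrightarrow> 0 < s \<Longrightarrow> s \<le> 1 \<Longrightarrow> h (x / s) \<le> 2 powr ((1 + \<alpha>) / 2) * s powr - ((1 + \<alpha>) / 2) * h x"
  proof (rule potter_bounds[OF mono nonneg rv(2) rv(3)[OF zero_less_numeral] order_refl \<alpha>(1) \<alpha>'])
    fix X assume "X > 0" "\<And>x. x \<ge> X \<Longrightarrow> h x > 0"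
      "\<And>x s. x \<ge> X \<Longrightarrow> 0 < s \<Longrightarrow> s \<le> 1 \<Longrightarrow> h (x / s) \<le> 2 powr ((1 + \<alpha>) / 2) * s powr - ((1 + \<alpha>) / 2) * h x"
    then show thesis by (rule that)
  qed
  show summ: "summable a"
  proof (rule summable_of_counting[OF dec pos fin, where \<delta> = "1 / X" and q = "(1 + \<alpha>) / 2"])
    fix t :: real assume t: "0 < t" "t \<le> 1 / X"
    \<comment> \<open>The bound is read at \<open>x = X\<close> and \<open>s = X * t\<close>, where
      \<open>X / (X * t) = 1 / t\<close> recovers the count at \<open>t\<close>.\<close>
    then have "h (X / (X * t)) \<le> 2 powr ((1 + \<alpha>) / 2) * (X * t) powr - ((1 + \<alpha>) / 2) * h X"
      using X(1) by (intro X(3)) (auto simp: field_simps)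
    then show "real (counting a t) \<le> (2 powr ((1 + \<alpha>) / 2) * X powr - ((1 + \<alpha>) / 2) * h X) * t powr - ((1 + \<alpha>) / 2)"
      using X(1) t by (simp add: h_def powr_mult mult_ac)
  qed (use X \<alpha> in auto)
  have summ_ln: "summable (\<lambda>j. ln (1 + n * a j))" if "n > 0" for n
  proof (rule summable_comparison_test)
    show "\<exists>N. \<forall>j\<ge>N. norm (ln (1 + n * a j)) \<le> n * a j"
      using that pos by (auto simp: less_imp_le ln_add_one_self_le_self)
  qed (intro summable_mult summ)
  have "((\<lambda>x. (LINT s:{0<..}|lborel. h (x / s) / (1 + s)) / h x) \<longlongrightarrow> pi / sin (pi * \<alpha>)) at_top"
  proof (rule abelian_stieltjes[OF mono nonneg rv(2) rv(3) \<alpha>])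
    show "1 / a 0 > 0" using pos by simp
    show "h x = 0" if "x < 1 / a 0" for x
    proof (cases "x > 0")
      case True
      then have "a 0 < 1 / x" using that pos[of 0] by (simp add: field_simps)
      then have "\<not> a j \<ge> 1 / x" for j
        using decseqD[OF dec, of 0 j] by simp
      then show ?thesis by (simp add: h_def counting_def)
    next
      case False
      \<comment> \<open>For \<open>x \<le> 0\<close> monotonicity compares with a positive point
        whose threshold \<open>a 0 + 1\<close> exceeds every \<open>a j\<close>.\<close>
      have "0 \<le> 1 / (a 0 + 1)" using pos[of 0] by simp
      then have "x \<le> 1 / (a 0 + 1)" using False by linarith
      then have "h x \<le> h (1 / (a 0 + 1))"
        by (rule monoD[OF mono])
      moreover have "\<not> a j \<ge> a 0 + 1" for j
        using decseqD[OF dec, of 0 j] by simp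
      then have "{j. a j \<ge> a 0 + 1} = {}" by blast
      then have "h (1 / (a 0 + 1)) = 0" by (simp add: h_def counting_def)
      ultimately show ?thesis using nonneg[of x] by linarith
    qed
  qed
  then have "((\<lambda>n. (\<Sum>j. ln (1 + n * a j)) / h n) \<longlongrightarrow> pi / sin (pi * \<alpha>)) at_top"
  proof (rule Lim_transform_eventually)
    show "eventually (\<lambda>n. (LINT s:{0<..}|lborel. h (n / s) / (1 + s)) / h n = (\<Sum>j. ln (1 + n * a j)) / h n) at_top"
      using eventually_gt_at_top[of 0]
      by eventually_elim (simp add: h_def sums_ln_eq_integral_counting[OF fin pos summ_ln])
  qed
  moreover have "sin (pi * \<alpha>) > 0"
    using \<alpha> by (intro sin_gt_zero) auto
  ultimately have "(\<lambda>n. (\<Sum>j. ln (1 + n * a j)) / h n) \<sim>[at_top] (\<lambda>_. pi / sin (pi * \<alpha>))"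
    by (intro tendsto_imp_asymp_equiv_const) auto
  from asymp_equiv_mult[OF this rv(1)]
  have *: "(\<lambda>n. (\<Sum>j. ln (1 + n * a j)) / h n * h n) \<sim>[at_top] (\<lambda>n. pi / sin (pi * \<alpha>) * (C * n powr \<alpha> * L n))" .
  have "(\<lambda>n. \<Sum>j. ln (1 + n * a j)) \<sim>[at_top] (\<lambda>n. (\<Sum>j. ln (1 + n * a j)) / h n * h n)"
    using rv(2) by (intro asymp_equiv_refl_ev) (auto elim!: eventually_mono)
  also note *
  finally show "(\<lambda>n. \<Sum>j. ln (1 + n * a j)) \<sim>[at_top] (\<lambda>n. C * pi * (1 / sin (pi * \<alpha>)) * n powr \<alpha> * L n)"
    by (simp add: mult_ac)
qed

subsection \<open>Divergence of infinite product measures\<close>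

text \<open>Fatou along the subsequence turns the Cauchy bound between \<open>s n\<close> and
  \<open>s (r k)\<close> into a bound between \<open>s n\<close> and \<open>f\<close>. The lemma
  serves both the partial densities under \<open>Q\<close> and the partial log-densities under
  \<open>P\<close>.\<close>

lemma L1_limit_of_subseq:
  fixes s :: "nat \<Rightarrow> 'a \<Rightarrow> real"
  assumes int: "\<And>n. integrable M (s n)" and f[measurable]: "f \<in> borel_measurable M"
    and r: "strict_mono r" and lim: "AE x in M. (\<lambda>k. s (r k) x) \<longlonglongrightarrow> f x"
    and cauchy: "\<And>e. e > 0 \<Longrightarrow> \<exists>N. \<forall>i\<ge>N. \<forall>j\<ge>N. (LINT x|M. norm (s i x - s j x)) < e"
  shows "integrable M f" and "(\<lambda>n. LINT x|M. norm (s n x - f x)) \<longlonglongrightarrow> 0"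
proof -
  have [measurable]: "s n \<in> borel_measurable M" for n
    using int by auto
  have main: "\<exists>N. \<forall>n\<ge>N. integrable M (\<lambda>x. s n x - f x) \<and> (LINT x|M. norm (s n x - f x)) \<le> e" if "e > 0" for e
  proof -
    obtain N where N: "\<And>i j. i \<ge> N \<Longrightarrow> j \<ge> N \<Longrightarrow> (LINT x|M. norm (s i x - s j x)) < e"
      using cauchy[OF \<open>e > 0\<close>] by blast
    have "integrable M (\<lambda>x. s n x - f x) \<and> (LINT x|M. norm (s n x - f x)) \<le> e" if n: "n \<ge> N" for n
    proof -
      have "(\<integral>\<^sup>+x. ennreal (norm (s n x - f x)) \<partial>M) = (\<integral>\<^sup>+x. liminf (\<lambda>k. ennreal (norm (s n x - s (r k) x))) \<partial>M)"
      proof (rule nn_integral_cong_AE, use lim in eventually_elim)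
        fix x assume "(\<lambda>k. s (r k) x) \<longlonglongrightarrow> f x"
        then have "(\<lambda>k. ennreal (norm (s n x - s (r k) x))) \<longlonglongrightarrow> ennreal (norm (s n x - f x))"
          by (intro tendsto_intros)
        then show "ennreal (norm (s n x - f x)) = liminf (\<lambda>k. ennreal (norm (s n x - s (r k) x)))"
          by (intro lim_imp_Liminf[symmetric]) auto
      qed
      also have "\<dots> \<le> liminf (\<lambda>k. \<integral>\<^sup>+x. ennreal (norm (s n x - s (r k) x)) \<partial>M)"
        by (rule nn_integral_liminf) auto
      also have "\<dots> \<le> liminf (\<lambda>k. ennreal e)"
      proof (rule Liminf_mono)
        show "\<forall>\<^sub>F k in sequentially. (\<integral>\<^sup>+x. ennreal (norm (s n x - s (r k) x)) \<partial>M) \<le> ennreal e"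
          using eventually_ge_at_top[of N]
        proof eventually_elim
          case (elim k)
          then have "r k \<ge> N" using seq_suble[OF r, of k] by simp
          have "(\<integral>\<^sup>+x. ennreal (norm (s n x - s (r k) x)) \<partial>M) = ennreal (LINT x|M. norm (s n x - s (r k) x))"
            by (intro nn_integral_eq_integral integrable_norm Bochner_Integration.integrable_diff int) auto
          also have "\<dots> \<le> ennreal e"
            using N[OF n \<open>r k \<ge> N\<close>] by (intro ennreal_leI) auto
          finally show ?case .
        qed
      qed
      also have "\<dots> = ennreal e"
        by (intro lim_imp_Liminf) auto
      finally have le: "(\<integral>\<^sup>+x. ennreal (norm (s n x - f x)) \<partial>M) \<le> ennreal e" .
      then have int': "integrable M (\<lambda>x. s n x - f x)"
        by (intro integrableI_bounded) (auto intro: le_less_trans)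
      moreover have "ennreal (LINT x|M. norm (s n x - f x)) \<le> ennreal e"
        using le by (subst nn_integral_eq_integral[symmetric]) (auto intro!: integrable_norm int' simp del: real_norm_def)
      ultimately show ?thesis
        using \<open>e > 0\<close> by (simp add: ennreal_le_iff)
    qed
    then show ?thesis by blast
  qed
  from main[of 1] obtain N where "integrable M (\<lambda>x. s N x - f x)" by auto
  from Bochner_Integration.integrable_diff[OF int[of N] this] show "integrable M f" by simp
  show "(\<lambda>n. LINT x|M. norm (s n x - f x)) \<longlonglongrightarrow> 0"
  proof (rule LIMSEQ_I)
    fix e :: real assume "e > 0"
    then obtain N where N: "\<And>n. n \<ge> N \<Longrightarrow> (LINT x|M. norm (s n x - f x)) \<le> e / 2"
      using main[of "e / 2"] by auto
    have "norm ((LINT x|M. norm (s n x - f x)) - 0) < e" if "n \<ge> N" for n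
    proof -
      have "(LINT x|M. norm (s n x - f x)) \<ge> 0" by simp
      then show ?thesis using N[OF that] \<open>e > 0\<close> by simp
    qed
    then show "\<exists>N. \<forall>n\<ge>N. norm ((LINT x|M. norm (s n x - f x)) - 0) < e" by blast
  qed
qed

lemma (in product_prob_space) indep_vars_coordinates:
  assumes "I \<noteq> {}"
  shows "P.indep_vars M (\<lambda>i x. x i) I"
proof (subst P.indep_vars_iff_distr_eq_PiM'[OF assms])
  have "distr (Pi\<^sub>M I M) (Pi\<^sub>M I M) (\<lambda>x. \<lambda>i\<in>I. x i) = distr (Pi\<^sub>M I M) (Pi\<^sub>M I M) (\<lambda>x. x)"
    by (rule distr_cong) (auto simp: space_PiM)
  also have "\<dots> = (\<Pi>\<^sub>M i\<in>I. distr (Pi\<^sub>M I M) (M i) (\<lambda>x. x i))"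
    by (subst distr_id) (auto intro!: PiM_cong simp: PiM_component)
  finally show "distr (Pi\<^sub>M I M) (Pi\<^sub>M I M) (\<lambda>x. \<lambda>i\<in>I. x i) = (\<Pi>\<^sub>M i\<in>I. distr (Pi\<^sub>M I M) (M i) (\<lambda>x. x i))" .
qed auto

lemma (in product_prob_space) nn_integral_PiM_prod_coordinates:
  assumes J: "finite J" "J \<subseteq> I" and g: "\<And>i. i \<in> J \<Longrightarrow> g i \<in> borel_measurable (M i)"
  shows "(\<integral>\<^sup>+x. (\<Prod>i\<in>J. g i (x i)) \<partial>Pi\<^sub>M I M) = (\<Prod>i\<in>J. \<integral>\<^sup>+y. g i y \<partial>M i)"
proof (cases "J = {}")
  case False
  then have "P.indep_vars M (\<lambda>i x. x i) J"
    using J by (intro P.indep_vars_subset[OF indep_vars_coordinates]) auto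
  then have "P.indep_vars (\<lambda>_. borel) (\<lambda>i x. g i (x i)) J"
    by (rule P.indep_vars_compose2) (rule g)
  then have "(\<integral>\<^sup>+x. (\<Prod>i\<in>J. g i (x i)) \<partial>Pi\<^sub>M I M) = (\<Prod>i\<in>J. \<integral>\<^sup>+x. g i (x i) \<partial>Pi\<^sub>M I M)"
    by (intro P.indep_vars_nn_integral J) auto
  also have "\<dots> = (\<Prod>i\<in>J. \<integral>\<^sup>+y. g i y \<partial>distr (Pi\<^sub>M I M) (M i) (\<lambda>x. x i))"
    using J g by (intro prod.cong refl nn_integral_distr[symmetric]) auto
  also have "\<dots> = (\<Prod>i\<in>J. \<integral>\<^sup>+y. g i y \<partial>M i)"
    using J by (intro prod.cong refl) (auto simp: PiM_component)
  finally show ?thesis .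
qed (simp add: P.emeasure_space_1)

lemma (in prob_space) expectation_sum_square_indep:
  fixes W :: "'i \<Rightarrow> 'a \<Rightarrow> real"
  assumes "finite A" and ind: "indep_vars (\<lambda>_. borel) W A"
    and int: "\<And>i. i \<in> A \<Longrightarrow> integrable M (W i)" "\<And>i. i \<in> A \<Longrightarrow> integrable M (\<lambda>x. (W i x)\<^sup>2)"
    and mean: "\<And>i. i \<in> A \<Longrightarrow> expectation (W i) = 0"
  shows "integrable M (\<lambda>x. (\<Sum>i\<in>A. W i x)\<^sup>2)"
    and "expectation (\<lambda>x. (\<Sum>i\<in>A. W i x)\<^sup>2) = (\<Sum>i\<in>A. expectation (\<lambda>x. (W i x)\<^sup>2))"
proof -
  have *: "integrable M (\<lambda>x. W i x * W j x) \<and>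
      expectation (\<lambda>x. W i x * W j x) = (if j = i then expectation (\<lambda>x. (W i x)\<^sup>2) else 0)"
    if "i \<in> A" "j \<in> A" for i j
  proof (cases "j = i")
    case True
    then show ?thesis using int(2)[OF that(1)] by (simp add: power2_eq_square)
  next
    case False
    have "indep_vars (\<lambda>_. borel) W {i, j}"
      using that by (intro indep_vars_subset[OF ind]) auto
    from indep_vars_lebesgue_integral[OF _ this] indep_vars_integrable[OF _ this] that int(1) mean False
    show ?thesis by (auto simp: eq_commute[of i j])
  qed
  have eq: "(\<lambda>x. (\<Sum>i\<in>A. W i x)\<^sup>2) = (\<lambda>x. \<Sum>i\<in>A. \<Sum>j\<in>A. W i x * W j x)"
    by (simp add: power2_eq_square sum_product)
  show "integrable M (\<lambda>x. (\<Sum>i\<in>A. W i x)\<^sup>2)"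
    unfolding eq using * by (intro Bochner_Integration.integrable_sum) auto
  have "expectation (\<lambda>x. (\<Sum>i\<in>A. W i x)\<^sup>2) = (\<Sum>i\<in>A. \<Sum>j\<in>A. expectation (\<lambda>x. W i x * W j x))"
    unfolding eq using * by (subst Bochner_Integration.integral_sum; (intro sum.cong refl Bochner_Integration.integral_sum Bochner_Integration.integrable_sum)?) auto
  also have "\<dots> = (\<Sum>i\<in>A. expectation (\<lambda>x. (W i x)\<^sup>2))"
    using * \<open>finite A\<close> by (intro sum.cong refl) (simp add: sum.delta)
  finally show "expectation (\<lambda>x. (\<Sum>i\<in>A. W i x)\<^sup>2) = (\<Sum>i\<in>A. expectation (\<lambda>x. (W i x)\<^sup>2))" .
qed

text \<open>This is nonnegativity of the variance of \<open>\<bar>X\<bar>\<close>.\<close>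

lemma (in prob_space) expectation_abs_le_sqrt:
  fixes X :: "'a \<Rightarrow> real"
  assumes [measurable]: "random_variable borel X" and int2: "integrable M (\<lambda>x. (X x)\<^sup>2)"
  shows "expectation (\<lambda>x. \<bar>X x\<bar>) \<le> sqrt (expectation (\<lambda>x. (X x)\<^sup>2))"
proof -
  have "integrable M (\<lambda>x. \<bar>X x\<bar>)"
    using square_integrable_imp_integrable[OF assms] by auto
  then have "variance (\<lambda>x. \<bar>X x\<bar>) = expectation (\<lambda>x. (X x)\<^sup>2) - (expectation (\<lambda>x. \<bar>X x\<bar>))\<^sup>2"
    using int2 by (subst variance_eq) auto
  with variance_positive[of "\<lambda>x. \<bar>X x\<bar>"] show ?thesis
    by (intro real_le_rsqrt) simp
qed

section \<open>Density and divergence of infinite products\<close>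

locale product_densities =
  fixes \<nu> :: "nat \<Rightarrow> 'a measure" and r :: "nat \<Rightarrow> 'a \<Rightarrow> real"
  assumes prob_\<nu>: "\<And>j. prob_space (\<nu> j)"
    and r_meas[measurable]: "\<And>j. r j \<in> borel_measurable (\<nu> j)"
    and r_pos: "\<And>j y. r j y > 0"
    and prob_\<mu>: "\<And>j. prob_space (density (\<nu> j) (r j))"
begin

abbreviation "\<mu> j \<equiv> density (\<nu> j) (r j)"
abbreviation "Q \<equiv> Pi\<^sub>M UNIV \<nu>"
abbreviation "P \<equiv> Pi\<^sub>M UNIV \<mu>"

definition R :: "nat \<Rightarrow> (nat \<Rightarrow> 'a) \<Rightarrow> real" where
  "R K x = (\<Prod>j<K. r j (x j))"

text \<open>The coordinate laws of an intermediate product between \<open>Q\<close> (for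
  \<open>K = 0\<close>) and \<open>P\<close>: \<open>R K\<close> changes only the first
  \<open>K\<close> coordinates.\<close>

definition mix :: "nat \<Rightarrow> nat \<Rightarrow> 'a measure" where
  "mix K j = (if j < K then \<mu> j else \<nu> j)"

lemma sets_mix[measurable_cong, simp]: "sets (mix K j) = sets (\<nu> j)"
  by (simp add: mix_def)

lemma space_mix[simp]: "space (mix K j) = space (\<nu> j)"
  by (simp add: mix_def)

lemma sets_PiM_mix[measurable_cong, simp]: "sets (Pi\<^sub>M UNIV (mix K)) = sets Q"
  by (intro sets_PiM_cong) auto

lemma sets_P[measurable_cong, simp]: "sets P = sets Q"
  by (intro sets_PiM_cong) auto

lemma R_meas[measurable]: "R K \<in> borel_measurable Q"
  unfolding R_def by measurable

lemma R_pos: "R K x > 0"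
  unfolding R_def by (intro prod_pos) (auto simp: r_pos)

sublocale nu: product_prob_space \<nu> UNIV
  by (intro product_prob_spaceI prob_\<nu>)

sublocale mu: product_prob_space \<mu> UNIV
  by (intro product_prob_spaceI prob_\<mu>)

lemma product_prob_space_mix: "product_prob_space (mix K)"
  by (intro product_prob_spaceI) (auto simp: mix_def prob_\<nu> prob_\<mu>)

text \<open>A product measure is determined by its values on cylinders, and there the integral of
  \<open>R K\<close> against \<open>Q\<close> factors over finitely many coordinates.\<close>

lemma density_R: "density Q (R K) = Pi\<^sub>M UNIV (mix K)"
proof -
  interpret mx: product_prob_space "mix K" UNIV
    by (rule product_prob_space_mix)
  show ?thesis
  proof (rule mx.PiM_eq)
    fix J F assume J: "finite J" and F: "\<And>j. j \<in> J \<Longrightarrow> F j \<in> sets (mix K j)"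
    let ?C = "prod_emb UNIV (mix K) J (Pi\<^sub>E J F)"
    \<comment> \<open>Each coordinate carries its density factor, its cylinder factor, or both, so
      that one product over \<open>J \<union> {..<K}\<close> covers everything. A coordinate below
      \<open>K\<close> outside \<open>J\<close> then integrates to the total mass one of
      \<open>\<mu> j\<close>.\<close>
    define g where "g j y = (if j < K then ennreal (r j y) else 1) * (if j \<in> J then indicator (F j) y else 1)" for j y
    have F': "F j \<in> sets (\<nu> j)" if "j \<in> J" for j
      using F[OF that] by simp
    have g[measurable]: "g j \<in> borel_measurable (\<nu> j)" for j
      unfolding g_def using F' by (cases "j \<in> J"; cases "j < K") auto
    have C: "?C \<in> sets Q"
      using J F by (subst sets_PiM_mix[of K, symmetric]) (intro sets_PiM_I; auto)
    have "emeasure (density Q (R K)) ?C = (\<integral>\<^sup>+x. ennreal (R K x) * indicator ?C x \<partial>Q)"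
      using C by (intro emeasure_density) auto
    also have "\<dots> = (\<integral>\<^sup>+x. (\<Prod>j\<in>J \<union> {..<K}. g j (x j)) \<partial>Q)"
    proof (rule nn_integral_cong)
      fix x assume x: "x \<in> space Q"
      have 1: "(\<Prod>j\<in>J \<union> {..<K}. if j < K then ennreal (r j (x j)) else 1) = ennreal (R K x)"
      proof -
        have "(\<Prod>j\<in>J \<union> {..<K}. if j < K then ennreal (r j (x j)) else 1) = (\<Prod>j<K. ennreal (r j (x j)))"
          using J by (intro prod.mono_neutral_cong_right) auto
        then show ?thesis
          by (simp add: R_def prod_ennreal r_pos less_imp_le)
      qed
      have 2: "(\<Prod>j\<in>J \<union> {..<K}. if j \<in> J then indicator (F j) (x j) else (1::ennreal)) = indicator ?C x"
      proof -
        have "(\<Prod>j\<in>J \<union> {..<K}. if j \<in> J then indicator (F j) (x j) else (1::ennreal)) = (\<Prod>j\<in>J. indicator (F j) (x j))"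
          using J by (intro prod.mono_neutral_cong_right) auto
        also have "\<dots> = indicator ?C x"
        proof (cases "\<forall>j\<in>J. x j \<in> F j")
          case True
          then show ?thesis using x by (auto simp: prod_emb_def space_PiM)
        next
          case False
          then obtain j where "j \<in> J" "x j \<notin> F j" by blast
          then show ?thesis using J by (auto simp: prod_emb_def space_PiM indicator_def PiE_iff)
        qed
        finally show ?thesis .
      qed
      show "ennreal (R K x) * indicator ?C x = (\<Prod>j\<in>J \<union> {..<K}. g j (x j))"
        unfolding g_def prod.distrib 1 2 ..
    qed
    also have "\<dots> = (\<Prod>j\<in>J \<union> {..<K}. \<integral>\<^sup>+y. g j y \<partial>\<nu> j)"
      using J by (intro nu.nn_integral_PiM_prod_coordinates) auto
    also have "\<dots> = (\<Prod>j\<in>J \<union> {..<K}. if j \<in> J then emeasure (mix K j) (F j) else 1)"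
    proof (rule prod.cong)
      fix j assume "j \<in> J \<union> {..<K}"
      consider "j < K" "j \<in> J" | "j < K" "j \<notin> J" | "\<not> j < K" "j \<in> J"
        using \<open>j \<in> J \<union> {..<K}\<close> by auto
      then show "(\<integral>\<^sup>+y. g j y \<partial>\<nu> j) = (if j \<in> J then emeasure (mix K j) (F j) else 1)"
      proof cases
        case 1
        then show ?thesis using F' by (simp add: g_def mix_def emeasure_density)
      next
        case 2
        then show ?thesis
          using prob_space.emeasure_space_1[OF prob_\<mu>, of j] by (simp add: g_def emeasure_density cong: nn_integral_cong)
      next
        case 3
        then show ?thesis using F' by (simp add: g_def mix_def)
      qed
    qed simp
    also have "\<dots> = (\<Prod>j\<in>J. emeasure (mix K j) (F j))"
      using J by (intro prod.mono_neutral_cong_right) auto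
    finally show "emeasure (density Q (R K)) ?C = (\<Prod>j\<in>J. emeasure (mix K j) (F j))" .
  qed simp
qed

lemma integrable_R: "integrable Q (R K)" and integral_R: "integral\<^sup>L Q (R K) = 1"
proof -
  interpret mx: product_prob_space "mix K" UNIV
    by (rule product_prob_space_mix)
  have "(\<integral>\<^sup>+x. ennreal (R K x) \<partial>Q) = emeasure (density Q (R K)) (space Q)"
    by (subst emeasure_density) (auto cong: nn_integral_cong)
  also have "\<dots> = 1"
    using mx.P.emeasure_space_1 by (simp add: density_R space_PiM)
  finally have *: "(\<integral>\<^sup>+x. ennreal (R K x) \<partial>Q) = 1" .
  then show "integrable Q (R K)"
    by (intro integrableI_nonneg) (auto simp: R_pos less_imp_le)
  show "integral\<^sup>L Q (R K) = 1"
    using * by (subst integral_eq_nn_integral) (auto simp: R_pos less_imp_le)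
qed

end

text \<open>The means are the divergences of the single coordinates. Their summability together with
  that of the variances makes blocks of log-densities far out small in mean under
  \<open>\<mu>\<close>.\<close>

locale product_densities_L2 = product_densities +
  assumes ln_r_sq: "\<And>j. integrable (\<mu> j) (\<lambda>y. (ln (r j y))\<^sup>2)"
    and mean_summable: "summable (\<lambda>j. integral\<^sup>L (\<mu> j) (\<lambda>y. ln (r j y)))"
    and var_summable: "summable (\<lambda>j. prob_space.variance (\<mu> j) (\<lambda>y. ln (r j y)))"
begin

abbreviation "E j \<equiv> integral\<^sup>L (\<mu> j) (\<lambda>y. ln (r j y))"
abbreviation "V j \<equiv> prob_space.variance (\<mu> j) (\<lambda>y. ln (r j y))"

definition logR :: "nat set \<Rightarrow> (nat \<Rightarrow> 'a) \<Rightarrow> real" where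
  "logR A x = (\<Sum>j\<in>A. ln (r j (x j)))"

lemma logR_meas[measurable]: "logR A \<in> borel_measurable Q"
  unfolding logR_def by measurable

lemma ln_r_integrable: "integrable (\<mu> j) (\<lambda>y. ln (r j y))"
  by (rule mu.M.square_integrable_imp_integrable[OF _ ln_r_sq]) auto

text \<open>Only the coordinates in \<open>A\<close> enter, so any product law agreeing with
  \<open>\<mu>\<close> on \<open>A\<close> has the same moments. This generality is used twice: for
  \<open>mix K\<close> when comparing partial densities and for \<open>P\<close> itself when
  comparing partial log-densities. The last bound is mean plus standard deviation, with the variance
  additive by independence.\<close>

lemma logR_moments:
  assumes m: "product_prob_space m" and A: "finite A" "\<And>j. j \<in> A \<Longrightarrow> m j = \<mu> j"
    and sets: "sets (Pi\<^sub>M UNIV m) = sets Q"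
  shows "integrable (Pi\<^sub>M UNIV m) (logR A)"
    and "integral\<^sup>L (Pi\<^sub>M UNIV m) (logR A) = sum E A"
    and "integral\<^sup>L (Pi\<^sub>M UNIV m) (\<lambda>x. \<bar>logR A x\<bar>) \<le> \<bar>sum E A\<bar> + sqrt (sum V A)"
proof -
  interpret m: product_prob_space m UNIV by (rule m)
  have [measurable_cong]: "sets (Pi\<^sub>M UNIV m) = sets Q" by (rule sets)
  have int: "integrable (Pi\<^sub>M UNIV m) (\<lambda>x. f (x j)) \<and> integral\<^sup>L (Pi\<^sub>M UNIV m) (\<lambda>x. f (x j)) = integral\<^sup>L (\<mu> j) f"
    if "j \<in> A" "integrable (\<mu> j) f" for j and f :: "'a \<Rightarrow> real"
  proof -
    have "\<mu> j = distr (Pi\<^sub>M UNIV m) (m j) (\<lambda>x. x j)"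
      using A(2)[OF that(1)] m.PiM_component[of j] by simp
    moreover have "f \<in> borel_measurable (m j)" using that A by simp
    ultimately show ?thesis
      using that(2) by (simp add: integrable_distr_eq integral_distr)
  qed
  have I1: "integrable (Pi\<^sub>M UNIV m) (\<lambda>x. ln (r j (x j)))" "integral\<^sup>L (Pi\<^sub>M UNIV m) (\<lambda>x. ln (r j (x j))) = E j"
    if "j \<in> A" for j
    using int[OF that ln_r_integrable] by auto
  show "integrable (Pi\<^sub>M UNIV m) (logR A)"
    unfolding logR_def by (intro Bochner_Integration.integrable_sum I1)
  show "integral\<^sup>L (Pi\<^sub>M UNIV m) (logR A) = sum E A"
    unfolding logR_def using I1 by (subst Bochner_Integration.integral_sum) auto
  define W where "W j x = ln (r j (x j)) - E j" for j x
  have sq: "integrable (\<mu> j) (\<lambda>y. (ln (r j y) - E j)\<^sup>2)" for j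
  proof -
    have "integrable (\<mu> j) (\<lambda>y. (ln (r j y))\<^sup>2 + (E j)\<^sup>2 - 2 * ln (r j y) * E j)"
      by (intro Bochner_Integration.integrable_diff Bochner_Integration.integrable_add integrable_mult_left integrable_mult_right ln_r_sq ln_r_integrable mu.M.integrable_const)
    then show ?thesis by (simp only: power2_diff)
  qed
  have "m.P.indep_vars m (\<lambda>j x. x j) A"
    by (rule m.P.indep_vars_subset[OF m.indep_vars_coordinates]) auto
  then have ind: "m.P.indep_vars (\<lambda>_. borel) W A"
    unfolding W_def using A by (intro m.P.indep_vars_compose2[where Y = "\<lambda>j y. ln (r j y) - E j" and X = "\<lambda>j x. x j"]) auto
  have W2: "integrable (Pi\<^sub>M UNIV m) (\<lambda>x. (W j x)\<^sup>2)" "m.P.expectation (\<lambda>x. (W j x)\<^sup>2) = V j" if "j \<in> A" for j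
    using int[OF that sq] by (auto simp: W_def)
  have W1: "integrable (Pi\<^sub>M UNIV m) (W j)" "m.P.expectation (W j) = 0" if "j \<in> A" for j
    using I1[OF that] m.P.prob_space unfolding W_def by auto
  note S = m.P.expectation_sum_square_indep[OF A(1) ind W1(1) W2(1) W1(2)]
  have Sint: "integrable (Pi\<^sub>M UNIV m) (\<lambda>x. \<Sum>j\<in>A. W j x)"
    by (intro Bochner_Integration.integrable_sum W1)
  have "m.P.expectation (\<lambda>x. \<bar>\<Sum>j\<in>A. W j x\<bar>) \<le> sqrt (sum V A)"
    using m.P.expectation_abs_le_sqrt[OF borel_measurable_integrable[OF Sint] S(1)] S(2) W2(2) by simp
  moreover have "integral\<^sup>L (Pi\<^sub>M UNIV m) (\<lambda>x. \<bar>logR A x\<bar>) \<le> m.P.expectation (\<lambda>x. \<bar>sum E A\<bar> + \<bar>\<Sum>j\<in>A. W j x\<bar>)"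
  proof (rule integral_mono)
    fix x
    have "logR A x = sum E A + (\<Sum>j\<in>A. W j x)"
      by (simp add: logR_def W_def sum_subtractf)
    then show "\<bar>logR A x\<bar> \<le> \<bar>sum E A\<bar> + \<bar>\<Sum>j\<in>A. W j x\<bar>" by linarith
  qed (use Sint \<open>integrable (Pi\<^sub>M UNIV m) (logR A)\<close> in auto)
  moreover have "m.P.expectation (\<lambda>x. \<bar>sum E A\<bar> + \<bar>\<Sum>j\<in>A. W j x\<bar>) = \<bar>sum E A\<bar> + m.P.expectation (\<lambda>x. \<bar>\<Sum>j\<in>A. W j x\<bar>)"
    using Sint m.P.prob_space by (subst Bochner_Integration.integral_add) auto
  ultimately show "integral\<^sup>L (Pi\<^sub>M UNIV m) (\<lambda>x. \<bar>logR A x\<bar>) \<le> \<bar>sum E A\<bar> + sqrt (sum V A)"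
    by linarith
qed

text \<open>
  Both \<open>R J\<close> and \<open>R K\<close> have integral one, so the \<open>L\<^sup>1\<close> distance is twice the integral of the
  positive part of \<open>R K - R J = R K * (1 - exp (- logR {J..<K}))\<close>, and \<open>1 - exp (- u) \<le> \<bar>u\<bar>\<close>.
\<close>

lemma R_diff_le:
  assumes "J \<le> K"
  shows "(LINT x|Q. \<bar>R K x - R J x\<bar>) \<le> 2 * (\<bar>sum E {J..<K}\<bar> + sqrt (sum V {J..<K}))"
proof -
  have split: "R K x = R J x * exp (logR {J..<K} x)" for x
  proof -
    have "R K x = R J x * (\<Prod>j\<in>{J..<K}. r j (x j))"
      using assms unfolding R_def by (subst prod.union_disjoint[symmetric]) (auto intro!: prod.cong)
    then show ?thesis
      by (simp add: logR_def exp_sum r_pos)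
  qed
  \<comment> \<open>This is \<open>\<bar>d\<bar> = 2 * max d 0 - d\<close> with the positive part
    replaced by its upper bound; the subtracted difference integrates to zero.\<close>
  have le: "\<bar>R K x - R J x\<bar> \<le> 2 * (R K x * \<bar>logR {J..<K} x\<bar>) - (R K x - R J x)" for x
  proof -
    have "1 - exp (- logR {J..<K} x) \<le> \<bar>logR {J..<K} x\<bar>"
      using exp_ge_add_one_self[of "- logR {J..<K} x"] by linarith
    then have "R K x * (1 - exp (- logR {J..<K} x)) \<le> R K x * \<bar>logR {J..<K} x\<bar>"
      using R_pos[of K x] by (intro mult_left_mono) auto
    moreover have "R K x * (1 - exp (- logR {J..<K} x)) = R K x - R J x"
      by (simp add: split[of x] algebra_simps flip: exp_add mult.assoc)
    moreover have "0 \<le> R K x * \<bar>logR {J..<K} x\<bar>"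
      using R_pos[of K x] by (intro mult_nonneg_nonneg) auto
    ultimately show ?thesis by linarith
  qed
  have K: "mix K j = \<mu> j" if "j \<in> {J..<K}" for j
    using that by (simp add: mix_def)
  note mom = logR_moments[OF product_prob_space_mix finite_atLeastLessThan K sets_PiM_mix]
  \<comment> \<open>The weight \<open>R K\<close> converts integrals under \<open>Q\<close> into
    integrals under \<open>mix K\<close>, whose coordinates in \<open>{J..<K}\<close> have law
    \<open>\<mu> j\<close>.\<close>
  have "integrable (density Q (R K)) (\<lambda>x. \<bar>logR {J..<K} x\<bar>)"
    unfolding density_R by (intro integrable_abs mom)
  then have int: "integrable Q (\<lambda>x. R K x * \<bar>logR {J..<K} x\<bar>)"
    by (subst (asm) integrable_density) (auto simp: R_pos less_imp_le)
  have eq: "(LINT x|Q. R K x * \<bar>logR {J..<K} x\<bar>) = (LINT x|Pi\<^sub>M UNIV (mix K). \<bar>logR {J..<K} x\<bar>)"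
    unfolding density_R[symmetric] by (subst integral_density) (auto simp: R_pos less_imp_le)
  have "(LINT x|Q. \<bar>R K x - R J x\<bar>) \<le> (LINT x|Q. 2 * (R K x * \<bar>logR {J..<K} x\<bar>) - (R K x - R J x))"
    by (rule integral_mono) (use le int integrable_R in auto)
  also have "\<dots> = 2 * (LINT x|Q. R K x * \<bar>logR {J..<K} x\<bar>)"
    using int integrable_R by (simp add: integral_R)
  also have "\<dots> \<le> 2 * (\<bar>sum E {J..<K}\<bar> + sqrt (sum V {J..<K}))"
    unfolding eq using mom(3) by (intro mult_left_mono) auto
  finally show ?thesis .
qed

lemma tails_small:
  assumes "e > 0"
  shows "\<exists>N. \<forall>J\<ge>N. \<forall>K\<ge>J. \<bar>sum E {J..<K}\<bar> + sqrt (sum V {J..<K}) < e"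
proof -
  have "e / 2 > 0" "(e / 2)\<^sup>2 > 0" using assms by auto
  obtain N1 where N1: "\<And>J K. J \<ge> N1 \<Longrightarrow> norm (sum E {J..<K}) < e / 2"
    using mean_summable \<open>e / 2 > 0\<close> unfolding summable_Cauchy by blast
  obtain N2 where N2: "\<And>J K. J \<ge> N2 \<Longrightarrow> norm (sum V {J..<K}) < (e / 2)\<^sup>2"
    using var_summable \<open>(e / 2)\<^sup>2 > 0\<close> unfolding summable_Cauchy by blast
  have "\<bar>sum E {J..<K}\<bar> + sqrt (sum V {J..<K}) < e" if "J \<ge> max N1 N2" "K \<ge> J" for J K
  proof -
    have "sqrt (sum V {J..<K}) < sqrt ((e / 2)\<^sup>2)"
      using N2[of J K] that by (intro real_sqrt_less_mono) auto
    also have "\<dots> = e / 2" using assms by simp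
    finally show ?thesis using N1[of J K] that by auto
  qed
  then show ?thesis by blast
qed

text \<open>Existence of a density is recorded separately because the later change of space needs
  absolute continuity, which the value of the divergence alone does not hand over
  conveniently.\<close>

lemma KL_product: "KL P Q = ereal (\<Sum>j. E j)"
  and density_product: "\<exists>f. f \<in> borel_measurable Q \<and> P = density Q (\<lambda>x. ennreal (f x))"
proof -
  have R_cauchy: "\<exists>N. \<forall>i\<ge>N. \<forall>j\<ge>N. (LINT x|Q. norm (R i x - R j x)) < e" if "e > 0" for e
  proof -
    obtain N where N: "\<And>J K. N \<le> J \<Longrightarrow> J \<le> K \<Longrightarrow> \<bar>sum E {J..<K}\<bar> + sqrt (sum V {J..<K}) < e / 2"
      using tails_small[OF half_gt_zero[OF \<open>e > 0\<close>]] by blast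
    have *: "(LINT x|Q. norm (R i x - R j x)) < e" if "N \<le> j" "j \<le> i" for i j
      using R_diff_le[OF that(2)] N[OF that] by simp
    have "(LINT x|Q. norm (R i x - R j x)) < e" if "N \<le> i" "N \<le> j" for i j
      using *[of i j] *[of j i] that by (cases "j \<le> i") (auto simp: norm_minus_commute simp del: real_norm_def)
    then show ?thesis by blast
  qed
  from cauchy_L1_AE_cauchy_subseq[OF integrable_R this]
  obtain k where k: "strict_mono k" "AE x in Q. Cauchy (\<lambda>i. R (k i) x)" by blast
  \<comment> \<open>\<open>lim\<close> is arbitrary where the subsequence diverges, which happens
    only on a null set of \<open>Q\<close>.\<close>
  define f where "f x = lim (\<lambda>i. R (k i) x)" for x
  have f[measurable]: "f \<in> borel_measurable Q"
    unfolding f_def by measurable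
  have f_lim: "AE x in Q. (\<lambda>i. R (k i) x) \<longlonglongrightarrow> f x"
    using k(2) unfolding f_def by eventually_elim (simp add: Cauchy_convergent_iff convergent_LIMSEQ_iff)
  note f_L1_lim = L1_limit_of_subseq[OF integrable_R f k(1) f_lim R_cauchy]
  have f_int: "integrable Q f"
    by (rule f_L1_lim(1))
  have f_L1: "(\<lambda>n. LINT x|Q. norm (R n x - f x)) \<longlonglongrightarrow> 0"
    by (rule f_L1_lim(2))
  have f_nonneg: "AE x in Q. f x \<ge> 0"
    using f_lim by eventually_elim (erule LIMSEQ_le_const, auto simp: R_pos less_imp_le)
  have PQ: "density Q f = P"
  proof (rule mu.PiM_eq)
    fix J F assume J: "finite J" and F: "\<And>j. j \<in> J \<Longrightarrow> F j \<in> sets (\<mu> j)"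
    let ?C = "prod_emb UNIV \<mu> J (Pi\<^sub>E J F)"
    have C[measurable]: "?C \<in> sets Q"
      using J F by (subst sets_P[symmetric]) (intro sets_PiM_I; auto)
    have int_R: "integrable Q (\<lambda>x. R n x * indicator ?C x)" for n
      using integrable_R[of n] by (intro integrable_real_mult_indicator) auto
    have int_f: "integrable Q (\<lambda>x. f x * indicator ?C x)"
      using f_int by (intro integrable_real_mult_indicator) auto
    have conv: "(\<lambda>n. LINT x|Q. R n x * indicator ?C x) \<longlonglongrightarrow> (LINT x|Q. f x * indicator ?C x)"
    proof (rule tendsto_norm_zero_cancel[THEN LIM_zero_cancel], rule tendsto_sandwich[OF _ _ tendsto_const f_L1])
      show "\<forall>\<^sub>F n in sequentially. norm ((LINT x|Q. R n x * indicator ?C x) - (LINT x|Q. f x * indicator ?C x)) \<le> (LINT x|Q. norm (R n x - f x))"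
      proof (rule always_eventually, rule allI)
        fix n
        have "norm ((LINT x|Q. R n x * indicator ?C x) - (LINT x|Q. f x * indicator ?C x))
            = norm (LINT x|Q. R n x * indicator ?C x - f x * indicator ?C x)"
          using int_R int_f by simp
        also have "\<dots> \<le> (LINT x|Q. norm (R n x * indicator ?C x - f x * indicator ?C x))"
          by (rule integral_norm_bound)
        also have "\<dots> \<le> (LINT x|Q. norm (R n x - f x))"
          using int_R int_f integrable_R f_int
          by (intro integral_mono integrable_norm Bochner_Integration.integrable_diff) (auto split: split_indicator)
        finally show "norm ((LINT x|Q. R n x * indicator ?C x) - (LINT x|Q. f x * indicator ?C x)) \<le> (LINT x|Q. norm (R n x - f x))" .
      qed
    qed auto
    obtain N where N: "\<And>j. j \<in> J \<Longrightarrow> j < N"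
      using J by (metis finite_nat_set_iff_bounded)
    \<comment> \<open>Once \<open>n\<close> exceeds every index in \<open>J\<close>,
      \<open>mix n\<close> agrees with \<open>\<mu>\<close> on the cylinder, so these integrals are
      eventually constant and the \<open>L\<^sup>1\<close> limit inherits their value.\<close>
    have ev: "\<forall>\<^sub>F n in sequentially. (LINT x|Q. R n x * indicator ?C x) = (\<Prod>j\<in>J. measure (\<mu> j) (F j))"
      using eventually_ge_at_top[of N]
    proof eventually_elim
      case (elim n)
      interpret mx: product_prob_space "mix n" UNIV
        by (rule product_prob_space_mix)
      have C': "?C = prod_emb UNIV (mix n) J (Pi\<^sub>E J F)"
        by (auto simp: prod_emb_def space_PiM)
      have "(LINT x|Q. R n x * indicator ?C x) = (LINT x|density Q (R n). indicator ?C x)"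
        by (subst integral_density) (auto simp: R_pos less_imp_le)
      also have "\<dots> = measure (density Q (R n)) ?C"
        using sets.sets_into_space[OF C] by (simp add: Int_absorb2)
      also have "\<dots> = (\<Prod>j\<in>J. measure (mix n j) (F j))"
        unfolding density_R C' using J F by (intro mx.measure_PiM_emb) auto
      also have "\<dots> = (\<Prod>j\<in>J. measure (\<mu> j) (F j))"
        using N elim by (intro prod.cong) (auto simp: mix_def dest: less_le_trans)
      finally show ?case .
    qed
    have val: "(LINT x|Q. f x * indicator ?C x) = (\<Prod>j\<in>J. measure (\<mu> j) (F j))"
      by (rule LIMSEQ_unique[OF conv tendsto_eventually[OF ev]])
    have "emeasure (density Q f) ?C = (\<integral>\<^sup>+x. ennreal (f x * indicator ?C x) \<partial>Q)"
      by (subst emeasure_density) (auto intro!: nn_integral_cong split: split_indicator)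
    also have "\<dots> = ennreal (LINT x|Q. f x * indicator ?C x)"
      using f_nonneg by (intro nn_integral_eq_integral int_f) (auto elim!: eventually_mono)
    also have "\<dots> = (\<Prod>j\<in>J. emeasure (\<mu> j) (F j))"
      unfolding val
      by (simp add: mu.M.emeasure_eq_measure prod_ennreal)
    finally show "emeasure (density Q f) ?C = (\<Prod>j\<in>J. emeasure (\<mu> j) (F j))" .
  qed simp
  then show "\<exists>f. f \<in> borel_measurable Q \<and> P = density Q (\<lambda>x. ennreal (f x))"
    using f by metis
  have ac: "absolutely_continuous Q P"
    unfolding PQ[symmetric] by (intro absolutely_continuousI_density) simp
  note to_P = absolutely_continuous_AE[OF sets_P ac]
  \<comment> \<open>Strict positivity is obtained under \<open>P\<close>, where it is automatic for
    a density; it is what permits taking logarithms of the limit.\<close>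
  have f_pos: "AE x in P. f x > 0"
    unfolding PQ[symmetric] by (subst AE_density) auto
  have "AE x in Q. ennreal (f x) = RN_deriv Q P x"
    by (rule nu.P.RN_deriv_unique) (auto simp: PQ)
  from to_P[OF this] f_pos have ed: "AE x in P. entropy_density (exp 1) Q P x = ln (f x)"
    by eventually_elim (simp add: entropy_density_def log_def, metis enn2real_ennreal less_imp_le)
  have ln_R: "ln (R n x) = logR {..<n} x" for n x
    unfolding R_def logR_def by (intro ln_prod) (auto simp: less_imp_neq[OF r_pos, symmetric])
  note mom = logR_moments[OF mu.product_prob_space_axioms _ refl sets_P]
  have logR_int: "integrable P (logR {..<n})" for n
    by (rule mom(1)) simp
  \<comment> \<open>The subsequence \<open>k\<close> found under \<open>Q\<close> is reused: its
    convergence passes to \<open>P\<close> by absolute continuity and to logarithms by continuity at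
    \<open>f x > 0\<close>.\<close>
  have logR_lim: "AE x in P. (\<lambda>i. logR {..<k i} x) \<longlonglongrightarrow> ln (f x)"
    using to_P[OF f_lim] f_pos
    by eventually_elim (auto simp flip: ln_R intro!: tendsto_ln)
  have logR_cauchy: "\<exists>N. \<forall>i\<ge>N. \<forall>j\<ge>N. (LINT x|P. norm (logR {..<i} x - logR {..<j} x)) < e" if "e > 0" for e
  proof -
    obtain N where N: "\<And>J K. N \<le> J \<Longrightarrow> J \<le> K \<Longrightarrow> \<bar>sum E {J..<K}\<bar> + sqrt (sum V {J..<K}) < e"
      using tails_small[OF \<open>e > 0\<close>] by blast
    have *: "(LINT x|P. norm (logR {..<i} x - logR {..<j} x)) < e" if "N \<le> j" "j \<le> i" for i j
    proof -
      have "logR {..<i} x - logR {..<j} x = logR {j..<i} x" for x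
        using that unfolding logR_def lessThan_atLeast0 by (intro sum_diff_nat_ivl) auto
      then show ?thesis
        using mom(3)[OF finite_atLeastLessThan, of j i] N[OF that] by simp
    qed
    have "(LINT x|P. norm (logR {..<i} x - logR {..<j} x)) < e" if "N \<le> i" "N \<le> j" for i j
      using *[of i j] *[of j i] that by (cases "j \<le> i") (auto simp: norm_minus_commute simp del: real_norm_def)
    then show ?thesis by blast
  qed
  have ln_f: "(\<lambda>x. ln (f x)) \<in> borel_measurable P"
    by measurable
  note ln_lim = L1_limit_of_subseq[OF logR_int ln_f k(1) logR_lim logR_cauchy]
  have ln_int: "integrable P (\<lambda>x. ln (f x))"
    by (rule ln_lim(1))
  have ln_L1: "(\<lambda>n. LINT x|P. norm (logR {..<n} x - ln (f x))) \<longlonglongrightarrow> 0"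
    by (rule ln_lim(2))
  have "(\<lambda>n. (LINT x|P. logR {..<n} x)) \<longlonglongrightarrow> (LINT x|P. ln (f x))"
  proof (rule tendsto_norm_zero_cancel[THEN LIM_zero_cancel], rule tendsto_sandwich[OF _ _ tendsto_const ln_L1])
    show "\<forall>\<^sub>F n in sequentially. norm ((LINT x|P. logR {..<n} x) - (LINT x|P. ln (f x))) \<le> (LINT x|P. norm (logR {..<n} x - ln (f x)))"
      by (intro always_eventually allI)
         (simp only: Bochner_Integration.integral_diff[OF logR_int ln_int, symmetric] integral_norm_bound)
  qed auto
  moreover have "(\<lambda>n. (LINT x|P. logR {..<n} x)) \<longlonglongrightarrow> (\<Sum>j. E j)"
    using mom(2)[OF finite_lessThan] summable_LIMSEQ[OF mean_summable] by simp
  ultimately have val: "(LINT x|P. ln (f x)) = (\<Sum>j. E j)"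
    by (rule LIMSEQ_unique)
  have ed_meas: "entropy_density (exp 1) Q P \<in> borel_measurable P"
    using measurable_entropy_density[of "exp 1" Q P] by (simp add: measurable_cong_sets[OF sets_P refl])
  show "KL P Q = ereal (\<Sum>j. E j)"
    using ac ln_int val integrable_cong_AE[OF ed_meas ln_f ed] integral_cong_AE[OF ed_meas ln_f ed]
    by (simp add: KL_def KL_divergence_def)
qed

end

subsection \<open>The Gaussian channel\<close>

text \<open>A measurable left inverse means that \<open>T\<close> loses no information: the
  Radon-Nikodym derivative of the images, composed with \<open>T\<close>, is the original one
  \<open>P\<close>-almost everywhere.\<close>

lemma KL_distr_inverse:
  assumes T[measurable]: "T \<in> measurable Q N" and T'[measurable]: "T' \<in> measurable N Q"
    and inv: "\<forall>x\<in>space Q. T' (T x) = x"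
    and Q: "sigma_finite_measure Q" and sets: "sets P = sets Q" and ac: "absolutely_continuous Q P"
  shows "KL (distr P N T) (distr Q N T) = KL P Q"
proof -
  interpret Q: sigma_finite_measure Q by fact
  have [measurable_cong]: "sets P = sets Q" by (rule sets)
  have ac': "absolutely_continuous (distr Q N T) (distr P N T)"
    using ac unfolding absolutely_continuous_def
    by (auto simp: null_sets_distr_iff sets_eq_imp_space_eq[OF sets])
  have "AE x in P. RN_deriv (distr Q N T) (distr P N T) (T x) = RN_deriv Q P x"
    by (rule absolutely_continuous_AE[OF sets ac]) (rule Q.RN_deriv_distr[OF T T' inv ac' sets])
  then have AE: "AE x in P. entropy_density (exp 1) (distr Q N T) (distr P N T) (T x) = entropy_density (exp 1) Q P x"
    by eventually_elim (simp add: entropy_density_def)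
  have [measurable]: "entropy_density (exp 1) (distr Q N T) (distr P N T) \<in> borel_measurable N"
    using measurable_entropy_density[of "exp 1" "distr Q N T" "distr P N T"] by simp
  have "integrable P (\<lambda>x. entropy_density (exp 1) (distr Q N T) (distr P N T) (T x)) \<longleftrightarrow> integrable P (entropy_density (exp 1) Q P)"
    using AE by (intro integrable_cong_AE) auto
  then have "integrable (distr P N T) (entropy_density (exp 1) (distr Q N T) (distr P N T)) \<longleftrightarrow> integrable P (entropy_density (exp 1) Q P)"
    by (subst integrable_distr_eq) auto
  moreover have "KL_divergence (exp 1) (distr Q N T) (distr P N T) = KL_divergence (exp 1) Q P"
    unfolding KL_divergence_def using AE by (subst integral_distr) (auto intro!: integral_cong_AE)
  ultimately show ?thesis
    using ac ac' by (simp add: KL_def)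
qed

context prob_space
begin

text \<open>The index type is a sum type so that one family expresses joint independence; the pairs
  come from its disjoint blocks \<open>{Inl j, Inr j}\<close>.\<close>

lemma indep_vars_pairs:
  fixes X Z :: "'i \<Rightarrow> 'a \<Rightarrow> real"
  assumes ind: "indep_vars (\<lambda>_. borel) (case_sum X Z) UNIV"
  shows "indep_vars (\<lambda>_. borel \<Otimes>\<^sub>M borel) (\<lambda>j \<omega>. (X j \<omega>, Z j \<omega>)) UNIV"
proof -
  have "indep_vars (\<lambda>j. PiM {Inl j, Inr j} (\<lambda>_. borel)) (\<lambda>j \<omega>. restrict (\<lambda>i. case_sum X Z i \<omega>) {Inl j, Inr j}) UNIV"
    by (rule indep_vars_restrict[OF ind]) (auto simp: disjoint_family_on_def)
  then have "indep_vars (\<lambda>_. borel \<Otimes>\<^sub>M borel)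
      (\<lambda>j \<omega>. (\<lambda>f. (f (Inl j), f (Inr j))) (restrict (\<lambda>i. case_sum X Z i \<omega>) {Inl j, Inr j})) UNIV"
    by (rule indep_vars_compose2) (auto intro!: measurable_Pair measurable_component_singleton)
  then show ?thesis by simp
qed

lemma indep_var_sequences:
  fixes X Z :: "'i \<Rightarrow> 'a \<Rightarrow> real"
  assumes ind: "indep_vars (\<lambda>_. borel) (case_sum X Z) UNIV"
  shows "indep_var (Pi\<^sub>M UNIV (\<lambda>_. borel)) (\<lambda>\<omega> j. X j \<omega>) (Pi\<^sub>M UNIV (\<lambda>_. borel)) (\<lambda>\<omega> j. Z j \<omega>)"
proof -
  have "indep_var (PiM (range Inl) (\<lambda>_. borel)) (\<lambda>\<omega>. restrict (\<lambda>i. case_sum X Z i \<omega>) (range Inl))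
      (PiM (range Inr) (\<lambda>_. borel)) (\<lambda>\<omega>. restrict (\<lambda>i. case_sum X Z i \<omega>) (range Inr))"
    by (rule indep_var_restrict[OF ind]) auto
  from indep_var_compose[OF this, of "\<lambda>f j. f (Inl j)" "Pi\<^sub>M UNIV (\<lambda>_. borel)" "\<lambda>f j. f (Inr j)" "Pi\<^sub>M UNIV (\<lambda>_. borel)"]
  show ?thesis
    by (simp add: comp_def measurable_PiM_single')
qed

lemma indep_var_pair:
  fixes X Z :: "'i \<Rightarrow> 'a \<Rightarrow> real"
  assumes ind: "indep_vars (\<lambda>_. borel) (case_sum X Z) UNIV"
  shows "indep_var borel (X j) borel (Z j)"
  using indep_var_compose[OF indep_var_sequences[OF ind], of "\<lambda>f. f j" borel "\<lambda>f. f j" borel]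
  by (simp add: comp_def)

lemma distr_sequence_eq_PiM:
  assumes "indep_vars (\<lambda>_. N) X UNIV"
  shows "distr M (Pi\<^sub>M UNIV (\<lambda>_. N)) (\<lambda>\<omega> j. X j \<omega>) = Pi\<^sub>M UNIV (\<lambda>j. distr M N (X j))"
  using assms indep_vars_iff_distr_eq_PiM'[where I = UNIV and M' = "\<lambda>_. N" and X = X]
  by (auto simp: indep_vars_def restrict_UNIV)

end

section \<open>Sequences of pairs versus pairs of sequences\<close>

text \<open>Independence over \<open>j\<close> describes laws on sequences of pairs, whereas mutual
  information compares laws on a pair of sequence spaces; this bijection links the two.\<close>

definition unzip :: "('i \<Rightarrow> 'a \<times> 'b) \<Rightarrow> ('i \<Rightarrow> 'a) \<times> ('i \<Rightarrow> 'b)" where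
  "unzip x = (\<lambda>j. fst (x j), \<lambda>j. snd (x j))"

lemma measurable_unzip[measurable]:
  "unzip \<in> measurable (Pi\<^sub>M UNIV (\<lambda>_. N \<Otimes>\<^sub>M K)) (Pi\<^sub>M UNIV (\<lambda>_. N) \<Otimes>\<^sub>M Pi\<^sub>M UNIV (\<lambda>_. K))"
  unfolding unzip_def
  by (intro measurable_Pair measurable_PiM_single') (auto simp: space_PiM space_pair_measure PiE_iff mem_Times_iff)

text \<open>Both sides are laws on one canonical space, the product of \<open>case_sum A B\<close>
  over the sum type. Grouping its independent coordinates into two halves gives the left side,
  grouping them into pairs gives the right.\<close>

lemma pair_PiM_eq_distr_unzip:
  fixes A B :: "'i \<Rightarrow> real measure"
  assumes A: "\<And>j. prob_space (A j)" "\<And>j. sets (A j) = sets borel"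
    and B: "\<And>j. prob_space (B j)" "\<And>j. sets (B j) = sets borel"
  shows "Pi\<^sub>M UNIV A \<Otimes>\<^sub>M Pi\<^sub>M UNIV B
    = distr (Pi\<^sub>M UNIV (\<lambda>j. A j \<Otimes>\<^sub>M B j)) (Pi\<^sub>M UNIV (\<lambda>_. borel) \<Otimes>\<^sub>M Pi\<^sub>M UNIV (\<lambda>_. borel)) unzip"
proof -
  let ?S = "case_sum A B" and ?seq = "Pi\<^sub>M UNIV (\<lambda>_. borel) :: ('i \<Rightarrow> real) measure"
  have sets: "sets (?S i) = sets borel" for i
    using A(2) B(2) by (cases i) auto
  interpret S: product_prob_space ?S UNIV
    using A(1) B(1) by (intro product_prob_spaceI) (auto split: sum.split)
  have [measurable_cong]: "sets (Pi\<^sub>M UNIV ?S) = sets (Pi\<^sub>M UNIV (\<lambda>_. borel))"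
    by (intro sets_PiM_cong sets refl)
  let ?X = "\<lambda>(j::'i) x. x (Inl j) :: real" and ?Z = "\<lambda>(j::'i) x. x (Inr j) :: real"
  have "S.P.indep_vars ?S (\<lambda>i x. x i) UNIV"
  proof (subst S.P.indep_vars_iff_distr_eq_PiM')
    have "distr (Pi\<^sub>M UNIV ?S) (Pi\<^sub>M UNIV ?S) (\<lambda>x. \<lambda>i\<in>UNIV. x i) = Pi\<^sub>M UNIV ?S"
      by (simp add: restrict_UNIV)
    then show "distr (Pi\<^sub>M UNIV ?S) (Pi\<^sub>M UNIV ?S) (\<lambda>x. \<lambda>i\<in>UNIV. x i) = (\<Pi>\<^sub>M i\<in>UNIV. distr (Pi\<^sub>M UNIV ?S) (?S i) (\<lambda>x. x i))"
      by (simp add: S.PiM_component)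
  qed auto
  then have "S.P.indep_vars (\<lambda>_. borel) (\<lambda>i x. (\<lambda>y. y) (x i)) UNIV"
    by (rule S.P.indep_vars_compose2) (simp add: measurable_cong_sets[OF sets refl])
  moreover have "(\<lambda>i x. x i) = case_sum ?X ?Z"
    by (auto simp: fun_eq_iff split: sum.split)
  ultimately have ind: "S.P.indep_vars (\<lambda>_. borel) (case_sum ?X ?Z) UNIV"
    by simp
  have X: "distr (Pi\<^sub>M UNIV ?S) borel (?X j) = A j" for j
  proof -
    have "distr (Pi\<^sub>M UNIV ?S) borel (?X j) = distr (Pi\<^sub>M UNIV ?S) (?S (Inl j)) (\<lambda>x. x (Inl j))"
      by (rule distr_cong) (auto simp: A)
    then show ?thesis by (subst (asm) S.PiM_component) auto
  qed
  have Z: "distr (Pi\<^sub>M UNIV ?S) borel (?Z j) = B j" for j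
  proof -
    have "distr (Pi\<^sub>M UNIV ?S) borel (?Z j) = distr (Pi\<^sub>M UNIV ?S) (?S (Inr j)) (\<lambda>x. x (Inr j))"
      by (rule distr_cong) (auto simp: B)
    then show ?thesis by (subst (asm) S.PiM_component) auto
  qed
  note pairs = S.P.indep_vars_pairs[OF ind]
  have indX: "S.P.indep_vars (\<lambda>_. borel) ?X UNIV"
    using S.P.indep_vars_compose2[OF pairs, of "\<lambda>_. fst" "\<lambda>_. borel"] by simp
  have indZ: "S.P.indep_vars (\<lambda>_. borel) ?Z UNIV"
    using S.P.indep_vars_compose2[OF pairs, of "\<lambda>_. snd" "\<lambda>_. borel"] by simp
  have pj: "distr (Pi\<^sub>M UNIV ?S) (borel \<Otimes>\<^sub>M borel) (\<lambda>x. (?X j x, ?Z j x)) = A j \<Otimes>\<^sub>M B j" for j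
    using S.P.indep_var_pair[OF ind, of j] unfolding S.P.indep_var_distribution_eq by (simp add: X Z)
  have "Pi\<^sub>M UNIV A \<Otimes>\<^sub>M Pi\<^sub>M UNIV B = distr (Pi\<^sub>M UNIV ?S) ?seq (\<lambda>x j. ?X j x) \<Otimes>\<^sub>M distr (Pi\<^sub>M UNIV ?S) ?seq (\<lambda>x j. ?Z j x)"
    unfolding S.P.distr_sequence_eq_PiM[OF indX] S.P.distr_sequence_eq_PiM[OF indZ] by (simp add: X Z)
  also have "\<dots> = distr (Pi\<^sub>M UNIV ?S) (?seq \<Otimes>\<^sub>M ?seq) (\<lambda>x. (\<lambda>j. ?X j x, \<lambda>j. ?Z j x))"
    using S.P.indep_var_sequences[OF ind] unfolding S.P.indep_var_distribution_eq by simp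
  also have "\<dots> = distr (distr (Pi\<^sub>M UNIV ?S) (Pi\<^sub>M UNIV (\<lambda>_. borel \<Otimes>\<^sub>M borel)) (\<lambda>x j. (?X j x, ?Z j x))) (?seq \<Otimes>\<^sub>M ?seq) unzip"
    by (subst distr_distr) (auto simp: unzip_def comp_def space_pair_measure intro!: measurable_PiM_single')
  also have "distr (Pi\<^sub>M UNIV ?S) (Pi\<^sub>M UNIV (\<lambda>_. borel \<Otimes>\<^sub>M borel)) (\<lambda>x j. (?X j x, ?Z j x)) = Pi\<^sub>M UNIV (\<lambda>j. A j \<Otimes>\<^sub>M B j)"
    unfolding S.P.distr_sequence_eq_PiM[OF pairs] by (simp add: pj)
  finally show ?thesis .
qed

text \<open>
  Density of the law of \<open>(X, k X + Z)\<close> with respect to the product of its marginals, for independent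
  \<open>X \<sim> N(0, \<tau>\<^sup>2)\<close> and \<open>Z \<sim> N(0, s\<^sup>2)\<close>.
\<close>

definition channel_density :: "real \<Rightarrow> real \<Rightarrow> real \<Rightarrow> real \<times> real \<Rightarrow> real" where
  "channel_density k \<tau> s = (\<lambda>(t, y). normal_density (k * t) s y / normal_density 0 (sqrt ((k * \<tau>)\<^sup>2 + s\<^sup>2)) y)"

lemma channel_density_pos:
  assumes "s > 0" shows "channel_density k \<tau> s p > 0"
proof -
  have "(k * \<tau>)\<^sup>2 + s\<^sup>2 > 0" using assms by (intro add_nonneg_pos) auto
  then show ?thesis
    using assms by (cases p) (auto simp: channel_density_def intro!: divide_pos_pos normal_density_pos)
qed

lemma borel_measurable_channel_density[measurable]:
  "channel_density k \<tau> s \<in> borel_measurable (borel \<Otimes>\<^sub>M borel)"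
  unfolding channel_density_def normal_density_def by measurable

text \<open>In standardised variables \<open>z\<close> and \<open>e\<close> the density depends only
  on \<open>x\<close>, the square root of the signal-to-noise ratio, since the output variance is
  \<open>s\<^sup>2 * (1 + x\<^sup>2)\<close>. The second summand is the part that has mean zero for
  independent standard normal \<open>z\<close> and \<open>e\<close>.\<close>

lemma ln_channel_density:
  fixes k \<tau> s z e :: real
  assumes s: "s > 0" and \<tau>: "\<tau> > 0"
  defines "x \<equiv> k * \<tau> / s"
  shows "ln (channel_density k \<tau> s (\<tau> * z, k * (\<tau> * z) + s * e))
    = ln (1 + x\<^sup>2) / 2 + (x\<^sup>2 * (z\<^sup>2 - e\<^sup>2) + 2 * x * (z * e)) / (2 * (1 + x\<^sup>2))"
proof -
  define v where "v = sqrt ((k * \<tau>)\<^sup>2 + s\<^sup>2)"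
  have "(k * \<tau>)\<^sup>2 + s\<^sup>2 > 0" using s by (intro add_nonneg_pos) auto
  have v2: "v\<^sup>2 = s\<^sup>2 * (1 + x\<^sup>2)" "v > 0"
    using \<open>(k * \<tau>)\<^sup>2 + s\<^sup>2 > 0\<close> s by (auto simp: v_def x_def field_simps)
  have x1: "1 + x\<^sup>2 > 0" by (intro add_pos_nonneg) auto
  have ln_nd: "ln (normal_density m w y) = - ln (2 * pi * w\<^sup>2) / 2 - (y - m)\<^sup>2 / (2 * w\<^sup>2)" if "w > 0" for m w y :: real
    using that by (simp add: normal_density_def ln_mult ln_div ln_sqrt) (simp add: field_simps)
  have kt: "k * (\<tau> * z) = s * (x * z)" using s by (simp add: x_def)
  have "ln (channel_density k \<tau> s (\<tau> * z, k * (\<tau> * z) + s * e))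
      = ln (normal_density (s * (x * z)) s (s * (x * z) + s * e)) - ln (normal_density 0 v (s * (x * z) + s * e))"
    using s v2 by (simp add: channel_density_def kt ln_div normal_density_pos less_imp_neq[symmetric] flip: v_def)
  also have "\<dots> = (ln (2 * pi * v\<^sup>2) - ln (2 * pi * s\<^sup>2)) / 2 + (s * (x * z) + s * e)\<^sup>2 / (2 * v\<^sup>2) - (s * e)\<^sup>2 / (2 * s\<^sup>2)"
    unfolding ln_nd[OF s] ln_nd[OF v2(2)] by (simp add: field_simps)
  also have "ln (2 * pi * v\<^sup>2) - ln (2 * pi * s\<^sup>2) = ln (1 + x\<^sup>2)"
    unfolding v2(1) using s x1 by (simp add: ln_mult)
  also have "(s * (x * z) + s * e)\<^sup>2 / (2 * v\<^sup>2) = (x * z + e)\<^sup>2 / (2 * (1 + x\<^sup>2))"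
    unfolding v2(1) using s x1 by (simp add: distrib_left[symmetric] power_mult_distrib)
  also have "(s * e)\<^sup>2 / (2 * s\<^sup>2) = e\<^sup>2 / 2"
    using s by (simp add: power_mult_distrib)
  also have "ln (1 + x\<^sup>2) / 2 + (x * z + e)\<^sup>2 / (2 * (1 + x\<^sup>2)) - e\<^sup>2 / 2
      = ln (1 + x\<^sup>2) / 2 + (x\<^sup>2 * (z\<^sup>2 - e\<^sup>2) + 2 * x * (z * e)) / (2 * (1 + x\<^sup>2))"
    using x1 by (simp add: divide_simps) (simp add: power2_eq_square algebra_simps)
  finally show ?thesis .
qed

text \<open>The factor \<open>x\<^sup>2\<close> is the point: at \<open>x\<^sup>2 = n * a j\<close>
  it makes the variances summable. The fourth powers are chosen for their explicit Gaussian
  expectation.\<close>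

lemma channel_fluctuation_sq_le:
  fixes x z e :: real
  shows "((x\<^sup>2 * (z\<^sup>2 - e\<^sup>2) + 2 * x * (z * e)) / (2 * (1 + x\<^sup>2)))\<^sup>2 \<le> x\<^sup>2 * (z ^ 4 + e ^ 4)"
proof -
  have x1: "1 + x\<^sup>2 \<ge> 1" by simp
  have "(x\<^sup>2 * (z\<^sup>2 - e\<^sup>2) + 2 * x * (z * e))\<^sup>2 \<le> 2 * (x\<^sup>2 * (z\<^sup>2 - e\<^sup>2))\<^sup>2 + 2 * (2 * x * (z * e))\<^sup>2"
    using sum_squares_bound[of "x\<^sup>2 * (z\<^sup>2 - e\<^sup>2)" "2 * x * (z * e)"] by (simp add: power2_sum)
  also have "\<dots> = 2 * x\<^sup>2 * (x\<^sup>2 * (z\<^sup>2 - e\<^sup>2)\<^sup>2 + 4 * (z * e)\<^sup>2)"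
    by (simp add: power2_eq_square algebra_simps)
  also have "\<dots> \<le> 2 * x\<^sup>2 * ((1 + x\<^sup>2) * (z\<^sup>2 - e\<^sup>2)\<^sup>2 + (1 + x\<^sup>2) * (4 * (z * e)\<^sup>2))"
    by (intro mult_left_mono add_mono mult_right_mono) (auto simp: algebra_simps)
  \<comment> \<open>This uses \<open>(z\<^sup>2 - e\<^sup>2)\<^sup>2 + 4 * (z * e)\<^sup>2 =
    (z\<^sup>2 + e\<^sup>2)\<^sup>2\<close>. The next step spends another factor
    \<open>1 + x\<^sup>2 \<ge> 1\<close> to match the squared denominator.\<close>
  also have "\<dots> = 2 * x\<^sup>2 * (1 + x\<^sup>2) * (z\<^sup>2 + e\<^sup>2)\<^sup>2"
    by (simp add: power2_eq_square algebra_simps)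
  also have "\<dots> \<le> 2 * x\<^sup>2 * (1 + x\<^sup>2)\<^sup>2 * (z\<^sup>2 + e\<^sup>2)\<^sup>2"
    using self_le_power[OF x1, of 2] by (intro mult_left_mono mult_right_mono) auto
  also have "\<dots> \<le> 2 * x\<^sup>2 * (1 + x\<^sup>2)\<^sup>2 * (2 * (z ^ 4 + e ^ 4))"
  proof (intro mult_left_mono)
    show "(z\<^sup>2 + e\<^sup>2)\<^sup>2 \<le> 2 * (z ^ 4 + e ^ 4)"
      using sum_squares_bound[of "z\<^sup>2" "e\<^sup>2"] by (simp add: power2_sum flip: power_mult)
  qed auto
  also have "\<dots> = x\<^sup>2 * (z ^ 4 + e ^ 4) * (2 * (1 + x\<^sup>2))\<^sup>2"
    unfolding power_mult_distrib by simp
  finally have "(x\<^sup>2 * (z\<^sup>2 - e\<^sup>2) + 2 * x * (z * e))\<^sup>2 \<le> x\<^sup>2 * (z ^ 4 + e ^ 4) * (2 * (1 + x\<^sup>2))\<^sup>2" .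
  moreover have "(2 * (1 + x\<^sup>2))\<^sup>2 > 0"
    by (intro zero_less_power mult_pos_pos add_pos_nonneg) auto
  ultimately show ?thesis
    unfolding power_divide by (simp only: pos_divide_le_eq)
qed

context prob_space
begin

lemma std_normal_moments:
  assumes D: "distributed M lborel X std_normal_density"
  shows "integrable M (\<lambda>\<omega>. X \<omega> ^ k)" "expectation X = 0" "expectation (\<lambda>\<omega>. (X \<omega>)\<^sup>2) = 1" "expectation (\<lambda>\<omega>. X \<omega> ^ 4) = 3"
proof -
  show "integrable M (\<lambda>\<omega>. X \<omega> ^ k)" for k
    using distributed_integrable[OF D, of "\<lambda>x. x ^ k"] integrable_std_normal_moment[of k] by simp
  have ex: "expectation (\<lambda>\<omega>. X \<omega> ^ k) = integral\<^sup>L lborel (\<lambda>x. std_normal_density x * x ^ k)" for k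
    using distributed_integral[OF D, of "\<lambda>x. x ^ k"] by simp
  show "expectation X = 0" by (rule standard_normal_distributed_expectation[OF D])
  show "expectation (\<lambda>\<omega>. (X \<omega>)\<^sup>2) = 1"
    unfolding ex using integral_std_normal_moment_even[of 1] by simp
  show "expectation (\<lambda>\<omega>. X \<omega> ^ 4) = 3"
    unfolding ex using integral_std_normal_moment_even[of 2] by (simp add: fact_numeral)
qed

text \<open>Given \<open>X = t\<close> the output is the noise shifted by \<open>k * t\<close>, with
  density \<open>normal_density (k * t) s\<close>; dividing by the marginal output density gives
  \<open>channel_density\<close>. Tonelli reduces the claim to a translation for each
  \<open>t\<close>.\<close>

lemma channel_law:
  fixes X Z :: "'a \<Rightarrow> real"
  assumes ind: "indep_var borel X borel Z"
    and X: "distributed M lborel X (normal_density 0 \<tau>)" and Z: "distributed M lborel Z (normal_density 0 s)"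
    and pos: "k > 0" "\<tau> > 0" "s > 0"
  shows "distr M (borel \<Otimes>\<^sub>M borel) (\<lambda>\<omega>. (X \<omega>, k * X \<omega> + Z \<omega>))
    = density (distr M borel X \<Otimes>\<^sub>M distr M borel (\<lambda>\<omega>. k * X \<omega> + Z \<omega>)) (channel_density k \<tau> s)"
proof (rule measure_eqI)
  define v where "v = sqrt ((k * \<tau>)\<^sup>2 + s\<^sup>2)"
  have v: "v > 0" using pos by (simp add: v_def add_pos_pos)
  have [measurable]: "X \<in> borel_measurable M" "Z \<in> borel_measurable M"
    using ind by (auto dest: indep_var_rv1 indep_var_rv2)
  have kX: "distributed M lborel (\<lambda>\<omega>. k * X \<omega>) (normal_density 0 (k * \<tau>))"
    using normal_density_affine[OF X pos(2), of k 0] pos by simp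
  have "indep_var borel (\<lambda>\<omega>. k * X \<omega>) borel Z"
    by (rule indep_var_compose[OF ind, of "\<lambda>x. k * x" borel "\<lambda>x. x" borel, unfolded comp_def]) auto
  from add_indep_normal[OF this _ _ kX Z]
  have Y: "distributed M lborel (\<lambda>\<omega>. k * X \<omega> + Z \<omega>) (normal_density 0 v)"
    using pos by (simp add: v_def)
  have dZ: "distr M borel Z = density lborel (normal_density 0 s)"
    using distributed_distr_eq_density[OF Z] by (simp cong: distr_cong)
  have dY: "distr M borel (\<lambda>\<omega>. k * X \<omega> + Z \<omega>) = density lborel (normal_density 0 v)"
    using distributed_distr_eq_density[OF Y] by (simp cong: distr_cong)
  interpret dZ: prob_space "density lborel (normal_density 0 s)"
    using pos(3) by (rule prob_space_normal_density)
  interpret dY: prob_space "density lborel (normal_density 0 v)"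
    using v by (rule prob_space_normal_density)
  fix A assume "A \<in> sets (distr M (borel \<Otimes>\<^sub>M borel) (\<lambda>\<omega>. (X \<omega>, k * X \<omega> + Z \<omega>)))"
  then have A[measurable]: "A \<in> sets (borel \<Otimes>\<^sub>M borel)" by simp
  have "emeasure (distr M (borel \<Otimes>\<^sub>M borel) (\<lambda>\<omega>. (X \<omega>, k * X \<omega> + Z \<omega>))) A
      = (\<integral>\<^sup>+p. indicator A p \<partial>distr M (borel \<Otimes>\<^sub>M borel) (\<lambda>\<omega>. (X \<omega>, k * X \<omega> + Z \<omega>)))"
    by simp
  also have "\<dots> = (\<integral>\<^sup>+\<omega>. indicator A (X \<omega>, k * X \<omega> + Z \<omega>) \<partial>M)"
    by (subst nn_integral_distr) auto
  also have "\<dots> = (\<integral>\<^sup>+p. indicator A (fst p, k * fst p + snd p) \<partial>distr M (borel \<Otimes>\<^sub>M borel) (\<lambda>\<omega>. (X \<omega>, Z \<omega>)))"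
    by (subst nn_integral_distr) auto
  also have "distr M (borel \<Otimes>\<^sub>M borel) (\<lambda>\<omega>. (X \<omega>, Z \<omega>)) = distr M borel X \<Otimes>\<^sub>M density lborel (normal_density 0 s)"
    using ind unfolding indep_var_distribution_eq by (simp add: dZ)
  also have "(\<integral>\<^sup>+p. indicator A (fst p, k * fst p + snd p) \<partial>(distr M borel X \<Otimes>\<^sub>M density lborel (normal_density 0 s)))
      = (\<integral>\<^sup>+t. \<integral>\<^sup>+z. indicator A (t, k * t + z) \<partial>density lborel (normal_density 0 s) \<partial>distr M borel X)"
    by (subst dZ.nn_integral_fst[symmetric]) auto
  also have "\<dots> = (\<integral>\<^sup>+t. \<integral>\<^sup>+y. ennreal (channel_density k \<tau> s (t, y)) * indicator A (t, y) \<partial>density lborel (normal_density 0 v) \<partial>distr M borel X)"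
  proof (rule nn_integral_cong)
    fix t :: real
    have "(\<integral>\<^sup>+z. indicator A (t, k * t + z) \<partial>density lborel (normal_density 0 s))
        = (\<integral>\<^sup>+z. ennreal (normal_density 0 s z) * indicator A (t, k * t + z) \<partial>lborel)"
      by (subst nn_integral_density) auto
    also have "\<dots> = (\<integral>\<^sup>+z. ennreal (normal_density (k * t) s (k * t + 1 * z)) * indicator A (t, k * t + 1 * z) \<partial>lborel)"
      by (simp add: normal_density_def)
    also have "\<dots> = (\<integral>\<^sup>+y. ennreal (normal_density (k * t) s y) * indicator A (t, y) \<partial>lborel)"
      by (subst (2) nn_integral_real_affine[where c = 1 and t = "k * t"]) auto
    also have "\<dots> = (\<integral>\<^sup>+y. ennreal (normal_density 0 v y) * (ennreal (channel_density k \<tau> s (t, y)) * indicator A (t, y)) \<partial>lborel)"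
    proof (rule nn_integral_cong)
      fix y
      have "normal_density 0 v y * channel_density k \<tau> s (t, y) = normal_density (k * t) s y"
        using normal_density_pos[OF v, of 0 y] by (simp add: channel_density_def v_def[symmetric])
      then show "ennreal (normal_density (k * t) s y) * indicator A (t, y)
          = ennreal (normal_density 0 v y) * (ennreal (channel_density k \<tau> s (t, y)) * indicator A (t, y))"
        by (simp add: mult.assoc[symmetric] ennreal_mult'[symmetric])
    qed
    also have "\<dots> = (\<integral>\<^sup>+y. ennreal (channel_density k \<tau> s (t, y)) * indicator A (t, y) \<partial>density lborel (normal_density 0 v))"
      by (subst nn_integral_density) auto
    finally show "(\<integral>\<^sup>+z. indicator A (t, k * t + z) \<partial>density lborel (normal_density 0 s))
      = (\<integral>\<^sup>+y. ennreal (channel_density k \<tau> s (t, y)) * indicator A (t, y) \<partial>density lborel (normal_density 0 v))" .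
  qed
  also have "\<dots> = (\<integral>\<^sup>+p. ennreal (channel_density k \<tau> s p) * indicator A p \<partial>(distr M borel X \<Otimes>\<^sub>M density lborel (normal_density 0 v)))"
    by (subst dY.nn_integral_fst[symmetric]) auto
  also have "\<dots> = emeasure (density (distr M borel X \<Otimes>\<^sub>M distr M borel (\<lambda>\<omega>. k * X \<omega> + Z \<omega>)) (channel_density k \<tau> s)) A"
    unfolding dY by (subst emeasure_density) auto
  finally show "emeasure (distr M (borel \<Otimes>\<^sub>M borel) (\<lambda>\<omega>. (X \<omega>, k * X \<omega> + Z \<omega>))) A
    = emeasure (density (distr M borel X \<Otimes>\<^sub>M distr M borel (\<lambda>\<omega>. k * X \<omega> + Z \<omega>)) (channel_density k \<tau> s)) A" .
qed simp

text \<open>In standardised variables the fluctuation \<open>U\<close> is centred because the second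
  moments of \<open>z\<close> and \<open>e\<close> cancel and \<open>z * e\<close> has mean zero.
  The constant 6 is the sum of two fourth moments equal to 3.\<close>

lemma channel_moments:
  fixes X Z :: "'a \<Rightarrow> real"
  assumes ind: "indep_var borel X borel Z"
    and X: "distributed M lborel X (normal_density 0 \<tau>)" and Z: "distributed M lborel Z (normal_density 0 s)"
    and pos: "k > 0" "\<tau> > 0" "s > 0"
  defines "\<mu> \<equiv> distr M (borel \<Otimes>\<^sub>M borel) (\<lambda>\<omega>. (X \<omega>, k * X \<omega> + Z \<omega>))"
  shows "integrable \<mu> (\<lambda>p. (ln (channel_density k \<tau> s p))\<^sup>2)"
    and "integral\<^sup>L \<mu> (\<lambda>p. ln (channel_density k \<tau> s p)) = ln (1 + (k * \<tau> / s)\<^sup>2) / 2"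
    and "prob_space.variance \<mu> (\<lambda>p. ln (channel_density k \<tau> s p)) \<le> 6 * (k * \<tau> / s)\<^sup>2"
proof -
  define x where "x = k * \<tau> / s"
  define z where "z = (\<lambda>\<omega>. X \<omega> / \<tau>)"
  define e where "e = (\<lambda>\<omega>. Z \<omega> / s)"
  have [measurable]: "X \<in> borel_measurable M" "Z \<in> borel_measurable M"
    using ind by (auto dest: indep_var_rv1 indep_var_rv2)
  have [measurable]: "z \<in> borel_measurable M" "e \<in> borel_measurable M"
    by (simp_all add: z_def e_def)
  have zD: "distributed M lborel z std_normal_density"
    using normal_density_affine[OF X pos(2), of "1 / \<tau>" 0] pos by (simp add: z_def)
  have eD: "distributed M lborel e std_normal_density"
    using normal_density_affine[OF Z pos(3), of "1 / s" 0] pos by (simp add: e_def)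
  have "indep_var borel z borel e"
    using indep_var_compose[OF ind, of "\<lambda>x. x / \<tau>" borel "\<lambda>x. x / s" borel] by (simp add: comp_def z_def e_def)
  note zm = std_normal_moments[OF zD] and em = std_normal_moments[OF eD]
  have zint: "integrable M z" and eint: "integrable M e"
    using zm(1)[of 1] em(1)[of 1] by simp_all
  have ze: "integrable M (\<lambda>\<omega>. z \<omega> * e \<omega>)" "expectation (\<lambda>\<omega>. z \<omega> * e \<omega>) = 0"
    using indep_var_integrable[OF \<open>indep_var borel z borel e\<close> zint eint]
      indep_var_lebesgue_integral[OF \<open>indep_var borel z borel e\<close> zint eint] zm(2) by auto
  define U where "U \<omega> = (x\<^sup>2 * ((z \<omega>)\<^sup>2 - (e \<omega>)\<^sup>2) + 2 * x * (z \<omega> * e \<omega>)) / (2 * (1 + x\<^sup>2))" for \<omega>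
  have [measurable]: "U \<in> borel_measurable M" unfolding U_def by measurable
  have ln_eq: "ln (channel_density k \<tau> s (X \<omega>, k * X \<omega> + Z \<omega>)) = ln (1 + x\<^sup>2) / 2 + U \<omega>" for \<omega>
    using ln_channel_density[OF pos(3,2), of k "z \<omega>" "e \<omega>"] pos by (simp add: z_def e_def x_def U_def)
  have Uint: "integrable M U"
    unfolding U_def using zm(1) em(1) ze by (intro integrable_divide integrable_mult_right Bochner_Integration.integrable_add Bochner_Integration.integrable_diff) auto
  have EU: "expectation U = 0"
    unfolding U_def using zm em ze by simp
  have bound: "(U \<omega>)\<^sup>2 \<le> x\<^sup>2 * (z \<omega> ^ 4 + e \<omega> ^ 4)" for \<omega>
    unfolding U_def by (rule channel_fluctuation_sq_le)
  have bint: "integrable M (\<lambda>\<omega>. x\<^sup>2 * (z \<omega> ^ 4 + e \<omega> ^ 4))"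
    using zm(1)[of 4] em(1)[of 4] by simp
  have U2: "integrable M (\<lambda>\<omega>. (U \<omega>)\<^sup>2)"
    by (rule Bochner_Integration.integrable_bound[OF bint]) (use bound in \<open>auto intro: order_trans\<close>)
  have EU2: "expectation (\<lambda>\<omega>. (U \<omega>)\<^sup>2) \<le> 6 * x\<^sup>2"
  proof -
    have "expectation (\<lambda>\<omega>. (U \<omega>)\<^sup>2) \<le> expectation (\<lambda>\<omega>. x\<^sup>2 * (z \<omega> ^ 4 + e \<omega> ^ 4))"
      by (intro integral_mono U2 bint bound)
    also have "\<dots> = 6 * x\<^sup>2"
      using zm(1)[of 4] em(1)[of 4] zm(4) em(4) by simp
    finally show ?thesis .
  qed
  have "integrable M (\<lambda>\<omega>. (ln (1 + x\<^sup>2) / 2 + U \<omega>)\<^sup>2)"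
    unfolding power2_sum using U2 Uint by simp
  then show "integrable \<mu> (\<lambda>p. (ln (channel_density k \<tau> s p))\<^sup>2)"
    unfolding \<mu>_def by (subst integrable_distr_eq) (auto simp: ln_eq)
  show E: "integral\<^sup>L \<mu> (\<lambda>p. ln (channel_density k \<tau> s p)) = ln (1 + (k * \<tau> / s)\<^sup>2) / 2"
    unfolding \<mu>_def using Uint EU prob_space by (subst integral_distr) (auto simp: ln_eq x_def)
  show "prob_space.variance \<mu> (\<lambda>p. ln (channel_density k \<tau> s p)) \<le> 6 * (k * \<tau> / s)\<^sup>2"
    unfolding E using EU2 unfolding \<mu>_def by (subst integral_distr) (auto simp: ln_eq x_def)
qed

end

subsection \<open>Information of the sequence experiment\<close>

text \<open>The coordinate laws instantiate \<open>product_densities_L2\<close>; the joint law and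
  the product of the two sequence laws are then the images of \<open>P\<close> and \<open>Q\<close>
  under \<open>unzip\<close>, which preserves the divergence.\<close>

lemma experiment_info_eq_sum:
  fixes M :: "'w measure" and \<theta> \<epsilon> :: "nat \<Rightarrow> 'w \<Rightarrow> real" and \<kappa> \<tau> a :: "nat \<Rightarrow> real"
  assumes M: "prob_space M"
    and pos: "\<And>j. \<kappa> j > 0" "\<And>j. \<tau> j > 0" "\<sigma> > 0"
    and \<theta>: "\<And>j. distributed M lborel (\<theta> j) (normal_density 0 (\<tau> j))"
    and \<epsilon>: "\<And>j. distributed M lborel (\<epsilon> j) (normal_density 0 \<sigma>)"
    and indep: "prob_space.indep_vars M (\<lambda>_. borel) (case_sum \<theta> \<epsilon>) UNIV"
    and a: "\<And>j. a j = (\<kappa> j)\<^sup>2 * (\<tau> j)\<^sup>2 / \<sigma>\<^sup>2" and summ: "summable a" and n: "n > 0"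
  shows "summable (\<lambda>j. ln (1 + n * a j))"
    and "2 * experiment_info M \<kappa> \<theta> \<epsilon> n = ereal (\<Sum>j. ln (1 + n * a j))"
proof -
  interpret prob_space M by fact
  define s where "s = n powr (- 1 / 2) * \<sigma>"
  define Z where "Z j \<omega> = n powr (- 1 / 2) * \<epsilon> j \<omega>" for j \<omega>
  define Y where "Y j \<omega> = \<kappa> j * \<theta> j \<omega> + Z j \<omega>" for j \<omega>
  have s: "s > 0" using n pos by (simp add: s_def)
  \<comment> \<open>The information level enters only here: scaling the noise by
    \<open>n powr (- 1 / 2)\<close> multiplies the signal-to-noise ratio by
    \<open>n\<close>.\<close>
  have x2: "(\<kappa> j * \<tau> j / s)\<^sup>2 = n * a j" for j
    using n pos(3) by (simp add: s_def a power_mult_distrib power_divide powr_minus powr_half_sqrt[of n] power_inverse flip: minus_divide_left)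
       (simp add: field_simps)
  have a_nonneg: "a j \<ge> 0" for j by (simp add: a)
  show summ_ln: "summable (\<lambda>j. ln (1 + n * a j))"
  proof (rule summable_comparison_test)
    show "\<exists>N. \<forall>j\<ge>N. norm (ln (1 + n * a j)) \<le> n * a j"
      using n a_nonneg by (auto simp: ln_add_one_self_le_self)
  qed (intro summable_mult summ)
  have indZ: "indep_vars (\<lambda>_. borel) (case_sum \<theta> Z) UNIV"
  proof -
    have "indep_vars (\<lambda>_. borel) (\<lambda>i \<omega>. case_sum (\<lambda>_ x. x) (\<lambda>_ x. n powr (- 1 / 2) * x) i (case_sum \<theta> \<epsilon> i \<omega>)) UNIV"
      by (rule indep_vars_compose2[OF indep]) (auto split: sum.split)
    also have "(\<lambda>i \<omega>. case_sum (\<lambda>_ x. x) (\<lambda>_ x. n powr (- 1 / 2) * x) i (case_sum \<theta> \<epsilon> i \<omega>)) = case_sum \<theta> Z"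
      by (auto simp: fun_eq_iff Z_def split: sum.split)
    finally show ?thesis .
  qed
  have rv[measurable]: "\<theta> j \<in> borel_measurable M" "Z j \<in> borel_measurable M" "Y j \<in> borel_measurable M" for j
    using indep_var_rv1[OF indep_var_pair[OF indZ, of j]] indep_var_rv2[OF indep_var_pair[OF indZ, of j]]
    by (auto simp: Y_def[abs_def])
  have Z: "distributed M lborel (Z j) (normal_density 0 s)" for j
    using normal_density_affine[OF \<epsilon> pos(3), of "n powr (- 1 / 2)" 0 j] n by (simp add: Z_def[abs_def] s_def)
  have pairs: "indep_vars (\<lambda>_. borel \<Otimes>\<^sub>M borel) (\<lambda>j \<omega>. (\<theta> j \<omega>, Y j \<omega>)) UNIV"
    using indep_vars_compose2[OF indep_vars_pairs[OF indZ], of "\<lambda>j (t, z). (t, \<kappa> j * t + z)" "\<lambda>_. borel \<Otimes>\<^sub>M borel"]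
    by (simp add: Y_def)
  have ind\<theta>: "indep_vars (\<lambda>_. borel) \<theta> UNIV"
    using indep_vars_compose2[OF pairs, of "\<lambda>_. fst" "\<lambda>_. borel"] by simp
  have indY: "indep_vars (\<lambda>_. borel) Y UNIV"
    using indep_vars_compose2[OF pairs, of "\<lambda>_. snd" "\<lambda>_. borel"] by simp
  define \<nu> where "\<nu> j = distr M borel (\<theta> j) \<Otimes>\<^sub>M distr M borel (Y j)" for j
  define r where "r j = channel_density (\<kappa> j) (\<tau> j) s" for j
  have sets_\<nu>: "sets (\<nu> j) = sets (borel \<Otimes>\<^sub>M borel)" for j
    unfolding \<nu>_def by (intro sets_pair_measure_cong) auto
  have law: "density (\<nu> j) (r j) = distr M (borel \<Otimes>\<^sub>M borel) (\<lambda>\<omega>. (\<theta> j \<omega>, Y j \<omega>))" for j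
    unfolding \<nu>_def r_def Y_def
    by (rule channel_law[OF indep_var_pair[OF indZ] \<theta> Z pos(1,2) s, symmetric])
  have mom: "integrable (density (\<nu> j) (r j)) (\<lambda>p. (ln (r j p))\<^sup>2)"
    "integral\<^sup>L (density (\<nu> j) (r j)) (\<lambda>p. ln (r j p)) = ln (1 + n * a j) / 2"
    "prob_space.variance (density (\<nu> j) (r j)) (\<lambda>p. ln (r j p)) \<le> 6 * (n * a j)" for j
    using channel_moments[OF indep_var_pair[OF indZ, of j] \<theta>[of j] Z[of j] pos(1)[of j] pos(2)[of j] s]
    unfolding law x2[symmetric] unfolding r_def Y_def by simp_all
  have prob_laws: "prob_space (distr M borel (\<theta> j))" "prob_space (distr M borel (Y j))" for j
    by (auto intro: prob_space_distr)
  interpret product_densities_L2 \<nu> r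
  proof (intro product_densities_L2.intro product_densities.intro product_densities_L2_axioms.intro)
    fix j
    show "prob_space (\<nu> j)"
      unfolding \<nu>_def by (intro prob_space_pair prob_laws)
    show "r j \<in> borel_measurable (\<nu> j)"
      unfolding r_def by (simp add: measurable_cong_sets[OF sets_\<nu> refl])
    show "r j y > 0" for y
      unfolding r_def by (rule channel_density_pos[OF s])
    show "prob_space (density (\<nu> j) (r j))"
      unfolding law by (rule prob_space_distr) measurable
    show "integrable (density (\<nu> j) (r j)) (\<lambda>y. (ln (r j y))\<^sup>2)"
      by (rule mom(1))
  next
    show "summable (\<lambda>j. integral\<^sup>L (density (\<nu> j) (r j)) (\<lambda>y. ln (r j y)))"
      unfolding mom(2) by (intro summable_divide summ_ln)
    show "summable (\<lambda>j. prob_space.variance (density (\<nu> j) (r j)) (\<lambda>y. ln (r j y)))"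
    proof (rule summable_comparison_test)
      show "\<exists>N. \<forall>j\<ge>N. norm (prob_space.variance (density (\<nu> j) (r j)) (\<lambda>y. ln (r j y))) \<le> 6 * (n * a j)"
        using mom(3) by (auto intro!: exI[of _ 0] simp: integral_nonneg_AE)
    qed (intro summable_mult summ)
  qed
  have P_eq: "P = distr M (Pi\<^sub>M UNIV (\<lambda>_. borel \<Otimes>\<^sub>M borel)) (\<lambda>\<omega> j. (\<theta> j \<omega>, Y j \<omega>))"
    unfolding law by (rule distr_sequence_eq_PiM[OF pairs, symmetric])
  have sets_Q: "sets Q = sets (Pi\<^sub>M UNIV (\<lambda>_. borel \<Otimes>\<^sub>M borel))"
    by (intro sets_PiM_cong sets_\<nu> refl)
  let ?zip = "\<lambda>(u, v) j. (u j, v j) :: real \<times> real"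
  have joint: "distr M (seq_space \<Otimes>\<^sub>M seq_space) (\<lambda>\<omega>. (\<lambda>j. \<theta> j \<omega>, \<lambda>j. Y j \<omega>)) = distr P (seq_space \<Otimes>\<^sub>M seq_space) unzip"
    unfolding P_eq by (subst distr_distr) (auto simp: comp_def unzip_def space_pair_measure intro!: measurable_PiM_single')
  have prod: "distr M seq_space (\<lambda>\<omega> j. \<theta> j \<omega>) \<Otimes>\<^sub>M distr M seq_space (\<lambda>\<omega> j. Y j \<omega>) = distr Q (seq_space \<Otimes>\<^sub>M seq_space) unzip"
    unfolding distr_sequence_eq_PiM[OF ind\<theta>] distr_sequence_eq_PiM[OF indY] \<nu>_def
    by (rule pair_PiM_eq_distr_unzip) (auto intro: prob_laws)
  obtain f where f: "f \<in> borel_measurable Q" "P = density Q (\<lambda>x. ennreal (f x))"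
    using density_product by blast
  have "experiment_info M \<kappa> \<theta> \<epsilon> n = KL (distr P (seq_space \<Otimes>\<^sub>M seq_space) unzip) (distr Q (seq_space \<Otimes>\<^sub>M seq_space) unzip)"
    unfolding joint[symmetric] prod[symmetric]
    by (simp add: experiment_info_def mutual_info_def observation_def Y_def Z_def)
  also have "\<dots> = KL P Q"
  proof (rule KL_distr_inverse)
    show "unzip \<in> measurable Q (seq_space \<Otimes>\<^sub>M seq_space)"
      by (simp add: measurable_cong_sets[OF sets_Q refl])
    have "?zip \<in> measurable (seq_space \<Otimes>\<^sub>M seq_space) (Pi\<^sub>M UNIV (\<lambda>_. borel \<Otimes>\<^sub>M borel))"
      by (rule measurable_PiM_single') (auto simp: space_pair_measure space_PiM split_beta')
    then show "?zip \<in> measurable (seq_space \<Otimes>\<^sub>M seq_space) Q"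
      by (simp add: measurable_cong_sets[OF refl sets_Q])
    show "\<forall>x\<in>space Q. ?zip (unzip x) = x"
      by (simp add: unzip_def)
    show "sigma_finite_measure Q" by unfold_locales
    show "sets P = sets Q" by simp
    show "absolutely_continuous Q P"
      unfolding f(2) using f(1) by (intro absolutely_continuousI_density) simp
  qed
  also have "\<dots> = ereal (\<Sum>j. ln (1 + n * a j) / 2)"
    unfolding KL_product mom(2) ..
  also have "(\<Sum>j. ln (1 + n * a j) / 2) = (\<Sum>j. ln (1 + n * a j)) / 2"
    by (rule suminf_divide[OF summ_ln])
  finally show "2 * experiment_info M \<kappa> \<theta> \<epsilon> n = ereal (\<Sum>j. ln (1 + n * a j))"
    by simp
qed

theorem theorem1:
  fixes M :: "'w measure"
    and \<theta> \<epsilon> :: "nat \<Rightarrow> 'w \<Rightarrow> real"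
    and \<kappa> \<tau> a :: "nat \<Rightarrow> real"
    and \<sigma> C \<alpha> :: real
    and L :: "real \<Rightarrow> real"
  assumes "prob_space M"
    and kappa_pos: "\<And>j. \<kappa> j > 0"
    and tau_pos: "\<And>j. \<tau> j > 0"
    and sigma_pos: "\<sigma> > 0"
    and theta_normal: "\<And>j. distributed M lborel (\<theta> j) (normal_density 0 (\<tau> j))"
    and eps_normal: "\<And>j. distributed M lborel (\<epsilon> j) (normal_density 0 \<sigma>)"
    and indep: "prob_space.indep_vars M (\<lambda>_. borel) (case_sum \<theta> \<epsilon>) (UNIV :: (nat + nat) set)"
    and a_eq: "\<And>j. a j = (\<kappa> j)\<^sup>2 * (\<tau> j)\<^sup>2 / \<sigma>\<^sup>2"
    and a_decreasing: "decseq a"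
    and C_pos: "C > 0"
    and alpha: "0 < \<alpha>" "\<alpha> < 1"
    and L_slowly_varying: "slowly_varying_at_top L"
    and counting_asymp:
      "(\<lambda>t. real (counting a t)) \<sim>[at_right 0] (\<lambda>t. C * t powr (- \<alpha>) * L (1 / t))"
  shows "summable a
    \<and> (\<forall>n>0. summable (\<lambda>j. ln (1 + n * a j))
             \<and> 2 * experiment_info M \<kappa> \<theta> \<epsilon> n = ereal (\<Sum>j. ln (1 + n * a j)))
    \<and> (\<lambda>n. real_of_ereal (2 * experiment_info M \<kappa> \<theta> \<epsilon> n))
         \<sim>[at_top] (\<lambda>n. C * pi * (1 / sin (pi * \<alpha>)) * n powr \<alpha> * L n)
    \<and> (\<lambda>n. real_of_ereal (effective_dim M \<kappa> \<theta> \<epsilon> n))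
         \<sim>[at_top] (\<lambda>n. C * pi * (1 / sin (pi * \<alpha>)) * (n powr \<alpha> * L n / ln n))"
proof -
  have a_pos: "a j > 0" for j
    unfolding a_eq using kappa_pos[of j] tau_pos[of j] sigma_pos by simp
  note sum_asymp = sum_ln_asymp[OF a_decreasing a_pos C_pos alpha L_slowly_varying counting_asymp]
  note info = experiment_info_eq_sum[OF assms(1) kappa_pos tau_pos sigma_pos theta_normal eps_normal indep a_eq sum_asymp(1)]
  have A: "(\<lambda>n. real_of_ereal (2 * experiment_info M \<kappa> \<theta> \<epsilon> n))
      \<sim>[at_top] (\<lambda>n. C * pi * (1 / sin (pi * \<alpha>)) * n powr \<alpha> * L n)"
  proof (rule asymp_equiv_trans[OF asymp_equiv_refl_ev sum_asymp(2)])
    show "eventually (\<lambda>n. real_of_ereal (2 * experiment_info M \<kappa> \<theta> \<epsilon> n) = (\<Sum>j. ln (1 + n * a j))) at_top"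
      using eventually_gt_at_top[of 0] by eventually_elim (simp only: info(2) real_of_ereal.simps)
  qed
  have "(\<lambda>n. real_of_ereal (effective_dim M \<kappa> \<theta> \<epsilon> n))
      \<sim>[at_top] (\<lambda>n. real_of_ereal (2 * experiment_info M \<kappa> \<theta> \<epsilon> n) / ln n)"
  proof (rule asymp_equiv_refl_ev)
    show "eventually (\<lambda>n. real_of_ereal (effective_dim M \<kappa> \<theta> \<epsilon> n) = real_of_ereal (2 * experiment_info M \<kappa> \<theta> \<epsilon> n) / ln n) at_top"
      \<comment> \<open>For \<open>n > 1\<close> the logarithm is nonzero, so the extended-real
        quotient of finite values is the ordinary real quotient.\<close>
      using eventually_gt_at_top[of 1]
    proof eventually_elim
      case (elim n)
      then have "n > 0" by simp
      then show ?case
        unfolding effective_dim_def info(2)[OF \<open>n > 0\<close>] using elim by simp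
    qed
  qed
  also have "(\<lambda>n. real_of_ereal (2 * experiment_info M \<kappa> \<theta> \<epsilon> n) / ln n)
      \<sim>[at_top] (\<lambda>n. C * pi * (1 / sin (pi * \<alpha>)) * n powr \<alpha> * L n / ln n)"
    by (intro asymp_equiv_intros A)
  finally have B: "(\<lambda>n. real_of_ereal (effective_dim M \<kappa> \<theta> \<epsilon> n))
      \<sim>[at_top] (\<lambda>n. C * pi * (1 / sin (pi * \<alpha>)) * (n powr \<alpha> * L n / ln n))"
    by (simp add: mult.assoc)
  show ?thesis
    by (intro conjI allI impI sum_asymp(1) info A B)
qed

end
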